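(* Consider the mixed clock ensemble and the observable canonical decomposition (associated with a weight vector $q\in\mathbb{R}^N$, $q^\top\mathbb{1}_N=1$) defined in the context. Let the input be $$u[k]=V^+\varphi[k],\qquad \varphi[k]=-\begin{bmatrix}F\otimes I_{N-1}&D\otimes VJ\end{bmatrix}\hat\eta_o[k],$$ where $\hat\eta_o[k]$ is the estimate of the observable state computed from the steady-state Kalman filter of the context, and let the feedback gains be structured as $$F=\begin{bmatrix}\frac{\gamma}{\tau}&1\end{bmatrix},\qquad D=\frac{\tau}{2},$$ where $\gamma$ is a scalar parameter. Then $$\lim_{k\to\infty}\mathbb{E}\big[p[k]-\mathbb{1}_N\theta_{\bar o}[k]\big]=0$$ if and only if $|1-\gamma|<1$, where the dynamics of the synchronization destination (unobservable state) is $$\eta_{\bar o}[k+1]=A\eta_{\bar o}[k]+(\beta\otimes q^\top J)\nu_o[k]+(I_2\otimes q^\top)v^x[k],\qquad \theta_{\bar o}[k]=C\eta_{\bar o}[k].$$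
   Context: Ensemble. A mixed ensemble of $N$ clocks contains a mixture of cesium-type (second-order) and hydrogen-maser-type (third-order) clocks; the last $M>0$ clocks are hydrogen-maser-type and the first $N-M$ are cesium-type. $\tau$ is the constant sampling interval. $\mathbb{1}_n$ is the all-ones column vector, $\otimes$ the Kronecker product, $\mathbb{E}$ expectation. Let $$A=\begin{bmatrix}1&\tau\\ 0&1\end{bmatrix},\ \beta=\begin{bmatrix}\tau^2/2\\ \tau\end{bmatrix},\ B=\begin{bmatrix}\tau\\ 1\end{bmatrix},\ C=\begin{bmatrix}1&0\end{bmatrix},\ J=\begin{bmatrix}0_{(N-M)\times M}\\ I_M\end{bmatrix}.$$ The ensemble state is $x[k]=[p[k]^\top\ f[k]^\top]^\top\in\mathbb{R}^{2N}$ (time/phase deviations $p[k]\in\mathbb{R}^N$, frequency states $f[k]\in\mathbb{R}^N$) and $z[k]\in\mathbb{R}^M$ (frequency drifts of the hydrogen-maser-type clocks), with input $u[k]\in\mathbb{R}^N$ and output $y[k]\in\mathbb{R}^{N-1}$: $$\begin{bmatrix}x[k+1]\\ z[k+1]\end{bmatrix}=\begin{bmatrix}A\otimes I_N&\beta\otimes J\\ 0&I_M\end{bmatrix}\begin{bmatrix}x[k]\\ z[k]\end{bmatrix}+\begin{bmatrix}B\otimes I_N\\ 0\end{bmatrix}u[k]+\begin{bmatrix}v^x[k]\\ v^z[k]\end{bmatrix},\quad y[k]=\begin{bmatrix}C\otimes V&0\end{bmatrix}\begin{bmatrix}x[k]\\ z[k]\end{bmatrix}+w[k],$$ where $V\in\mathbb{R}^{(N-1)\times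 N}$ satisfies $\ker V=\operatorname{im}\mathbb{1}_N$, $w$ is zero-mean white Gaussian noise with covariance $rI_{N-1}$, $r>0$, and the process noise $(v^x,v^z)$ is zero-mean white Gaussian with covariance (the clocks being independent of each other) $$Q=\begin{bmatrix}\tau\Sigma_1+\frac{\tau^3}{3}\Sigma_2+\frac{\tau^5}{20}\Sigma_3&\frac{\tau^2}{2}\Sigma_2+\frac{\tau^4}{8}\Sigma_3&\frac{\tau^3}{6}\Sigma_4\\ \frac{\tau^2}{2}\Sigma_2+\frac{\tau^4}{8}\Sigma_3&\tau\Sigma_2+\frac{\tau^3}{3}\Sigma_3&\frac{\tau^2}{2}\Sigma_4\\ \frac{\tau^3}{6}\Sigma_4^\top&\frac{\tau^2}{2}\Sigma_4^\top&\tau\Sigma_5\end{bmatrix},$$ with $\Sigma_1=\mathrm{diag}(\sigma_{1,1}^2,\dots,\sigma_{1,N}^2)$, $\Sigma_2=\mathrm{diag}(\sigma_{2,1}^2,\dots,\sigma_{2,N}^2)$, $\Sigma_5=\mathrm{diag}(\sigma_{3,N-M+1}^2,\dots,\sigma_{3,N}^2)$, $\Sigma_3=\mathrm{diag}(0_{(N-M)\times(N-M)},\Sigma_5)$, $\Sigma_4=\begin{bmatrix}0\\ \Sigma_5\end{bmatrix}\in\mathbb{R}^{N\times M}$. Here $\sigma_{1,i}$, $\sigma_{2,i}$, $\sigma_{3,i}$ are the standard deviations of the white frequency noise, random walk frequency noise and random run of frequency drift of clock $i$. Observable canonical decomposition. Let $q\in\mathbb{R}^N$ with $q^\top\mathbb{1}_N=1$.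 Let $W\in\mathbb{R}^{N\times(N-1)}$ be a full-column-rank matrix with $q^\top W=0$ and let $V^+=W(VW)^{-1}$, so $VV^+=I_{N-1}$. The observable state $\eta_o[k]\in\mathbb{R}^{2(N-1)+M}$ and the unobservable state $\eta_{\bar o}[k]\in\mathbb{R}^2$ are defined by $$\begin{bmatrix}x[k]\\ z[k]\end{bmatrix}=\begin{bmatrix}I_2\otimes V^+&0&I_2\otimes\mathbb{1}_N\\ 0&I_M&0\end{bmatrix}\begin{bmatrix}\eta_o[k]\\ \eta_{\bar o}[k]\end{bmatrix},$$ equivalently $\eta_o[k]=\mathbf{T}_o\begin{bmatrix}x[k]\\ z[k]\end{bmatrix}$ with $\mathbf{T}_o=\begin{bmatrix}I_2\otimes V&0\\ 0&I_M\end{bmatrix}$, and $\eta_{\bar o}[k]=(I_2\otimes q^\top)x[k]$. Partition $\eta_o[k]=\begin{bmatrix}\xi_o[k]\\ \nu_o[k]\end{bmatrix}$ with $\xi_o[k]\in\mathbb{R}^{2(N-1)}$, $\nu_o[k]\in\mathbb{R}^M$; thus $\nu_o[k]=z[k]$. Let $$\mathbf{A}_{oo}=\begin{bmatrix}A\otimes I_{N-1}&\beta\otimes VJ\\ 0&I_M\end{bmatrix},\quad \mathbf{B}_o=\begin{bmatrix}B\otimes V\\ 0\end{bmatrix},\quad \mathbf{C}_o=\begin{bmatrix}C\otimes I_{N-1}&0_{(N-1)\times M}\end{bmatrix}.$$ Steady-state Kalman filter (observable part): $$\hat\eta_o^-[k]=\mathbf{A}_{oo}\hat\eta_o[k-1]+\mathbf{B}_ou[k-1],\qquad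 \hat\eta_o[k]=\hat\eta_o^-[k]+L_o^*(y[k]-\mathbf{C}_o\hat\eta_o^-[k]),$$ where $L_o^*=P^*_{oo}\mathbf{C}_o^\top(\mathbf{C}_oP^*_{oo}\mathbf{C}_o^\top+rI_{N-1})^{-1}$ and $P^*_{oo}$, the steady-state prior error covariance of the observable state, is the unique solution of the Riccati equation $$P^*_{oo}=\mathbf{T}_oQ\mathbf{T}_o^\top+\mathbf{A}_{oo}P^*_{oo}\mathbf{A}_{oo}^\top-\mathbf{A}_{oo}P^*_{oo}\mathbf{C}_o^\top(\mathbf{C}_oP^*_{oo}\mathbf{C}_o^\top+rI_{N-1})^{-1}\mathbf{C}_oP^*_{oo}\mathbf{A}_{oo}^\top.$$
   Formalization: Nondegenerate noise is assumed: σ_{2,i}>0 for every cesium-type clock and σ_{3,i}>0 for every hydrogen-maser-type clock; with all σ zero the Kalman gain vanishes, the estimation error persists and the "if" direction fails. *)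

theory Defs
  imports "HOL-Probability.Probability"
begin

section \<open>Block matrices and Kronecker products\<close>

text \<open>
  Recall that \<open>real^'m^'n\<close> has rows indexed by \<open>'n\<close> and columns indexed by \<open>'m\<close>. A vector or
  matrix partitioned into two blocks is indexed by a sum type (\<open>Inl\<close>: first block, \<open>Inr\<close>: second
  block), and the row (column) index type of a Kronecker product is the product of the row (column)
  index types of its factors. In particular a state \<open>[p; f]\<close> with \<open>p\<close> and \<open>f\<close> indexed by \<open>'n\<close> has
  index type \<open>2 \<times> 'n\<close>; its first block is at \<open>(1, i)\<close> and its second block at \<open>(2, i)\<close>, in
  accordance with \<open>vector [a, b] $ 1 = a\<close> and \<open>vector [a, b] $ 2 = b\<close>.
\<close>

definition hcat :: "real^'b::finite^'r::finite \<Rightarrow> real^'d::finite^'r \<Rightarrow> real^('b + 'd)^'r" where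
  "hcat X Y = (\<chi> i j. case j of Inl b \<Rightarrow> X $ i $ b | Inr d \<Rightarrow> Y $ i $ d)"

definition vcat :: "'a^'b::finite \<Rightarrow> 'a^'d::finite \<Rightarrow> 'a^('b + 'd)" where
  "vcat X Y = (\<chi> i. case i of Inl b \<Rightarrow> X $ b | Inr d \<Rightarrow> Y $ d)"

definition upper :: "'a^('b::finite + 'd::finite) \<Rightarrow> 'a^'b" where
  "upper X = (\<chi> b. X $ Inl b)"

definition lower :: "'a^('b::finite + 'd::finite) \<Rightarrow> 'a^'d" where
  "lower X = (\<chi> d. X $ Inr d)"

definition block :: "real^'b::finite^'r::finite \<Rightarrow> real^'d::finite^'r \<Rightarrow> real^'b^'s::finite \<Rightarrow> real^'d^'s \<Rightarrow> real^('b + 'd)^('r + 's)"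
  where "block X11 X12 X21 X22 = vcat (hcat X11 X12) (hcat X21 X22)"

definition vcat2 :: "'a^'n::finite \<Rightarrow> 'a^'n \<Rightarrow> 'a^(2 \<times> 'n)" where
  "vcat2 X Y = (\<chi> k. if fst k = 1 then X $ snd k else Y $ snd k)"

definition hcat2 :: "real^'m::finite^'n::finite \<Rightarrow> real^'m^'n \<Rightarrow> real^(2 \<times> 'm)^'n" where
  "hcat2 X Y = (\<chi> i l. if fst l = 1 then X $ i $ snd l else Y $ i $ snd l)"

definition diagmat :: "real^'n::finite \<Rightarrow> real^'n^'n" where
  "diagmat d = (\<chi> i j. if i = j then d $ i else 0)"

definition kron :: "real^'b::finite^'a::finite \<Rightarrow> real^'d::finite^'c::finite \<Rightarrow> real^('b \<times> 'd)^('a \<times> 'c)"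
    (infixl \<open>\<otimes>\<^sub>K\<close> 75) where
  "X \<otimes>\<^sub>K Y = (\<chi> k l. X $ fst k $ fst l * Y $ snd k $ snd l)"

text \<open>
  If a factor of a Kronecker product has a single row or column, the index type has a factor of
  type \<open>1\<close>, which the following functions remove (\<open>1 \<times> 'c\<close> and \<open>'a \<times> 1\<close> are identified with \<open>'c\<close>
  and \<open>'a\<close>). The suffixes refer to the left and the right factor of the product.
\<close>

definition row_left :: "real^'m::finite^(1 \<times> 'c::finite) \<Rightarrow> real^'m^'c" where
  "row_left X = (\<chi> i j. X $ (1, i) $ j)"

definition row_right :: "real^'m::finite^('a::finite \<times> 1) \<Rightarrow> real^'m^'a" where
  "row_right X = (\<chi> i j. X $ (i, 1) $ j)"

definition col_left :: "real^(1 \<times> 'd::finite)^'n::finite \<Rightarrow> real^'d^'n" where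
  "col_left X = (\<chi> i j. X $ i $ (1, j))"


section \<open>Gaussian random vectors and white noise\<close>

definition psd :: "real^'n::finite^'n \<Rightarrow> bool" where
  "psd S \<longleftrightarrow> transpose S = S \<and> (\<forall>a. 0 \<le> a \<bullet> (S *v a))"

text \<open>
  A random vector is Gaussian if all its one-dimensional projections are Gaussian, where point
  masses count as Gaussian distributions of variance \<open>0\<close>.
\<close>

definition gaussian_vec :: "'w measure \<Rightarrow> ('w \<Rightarrow> real^'n::finite) \<Rightarrow> real^'n \<Rightarrow> real^'n^'n \<Rightarrow> bool" where
  "gaussian_vec \<Omega> X \<mu> S \<longleftrightarrow> X \<in> borel_measurable \<Omega> \<and> psd S \<and>
     (\<forall>a. distr \<Omega> borel (\<lambda>\<omega>. a \<bullet> X \<omega>) =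
        (if a \<bullet> (S *v a) = 0 then return borel (a \<bullet> \<mu>)
         else density lborel (normal_density (a \<bullet> \<mu>) (sqrt (a \<bullet> (S *v a))))))"

definition white_gaussian :: "'w measure \<Rightarrow> (nat \<Rightarrow> 'w \<Rightarrow> real^'n::finite) \<Rightarrow> real^'n^'n \<Rightarrow> bool" where
  "white_gaussian \<Omega> X S \<longleftrightarrow>
     (\<forall>k. gaussian_vec \<Omega> (X k) 0 S) \<and> prob_space.indep_vars \<Omega> (\<lambda>_. borel) X UNIV"


section \<open>The clock ensemble\<close>

text \<open>
  Cesium-type clocks are indexed by \<open>'c\<close> and hydrogen-maser-type clocks by \<open>'h\<close>, hence the whole
  ensemble by \<open>'c + 'h\<close>: \<open>N = CARD('c + 'h)\<close> and \<open>M = CARD('h)\<close>. The type \<open>'m\<close> indexes the \<open>N - 1\<close>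
  outputs.
\<close>

definition ones :: "real^'n::finite" where
  "ones = (\<chi> i. 1)"

definition Amat :: "real \<Rightarrow> real^2^2" where
  "Amat \<tau> = vector [vector [1, \<tau>], vector [0, 1]]"

definition \<beta>mat :: "real \<Rightarrow> real^1^2" where
  "\<beta>mat \<tau> = vector [vector [\<tau>\<^sup>2 / 2], vector [\<tau>]]"

definition Bmat :: "real \<Rightarrow> real^1^2" where
  "Bmat \<tau> = vector [vector [\<tau>], vector [1]]"

definition Cmat :: "real^2^1" where
  "Cmat = vector [vector [1, 0]]"

definition Jmat :: "real^'h::finite^('c::finite + 'h)" where
  "Jmat = vcat 0 (mat 1)"

definition noise_cov ::
    "real \<Rightarrow> real^('c::finite + 'h::finite) \<Rightarrow> real^('c + 'h) \<Rightarrow> real^'h \<Rightarrow>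
     real^(2 \<times> ('c + 'h) + 'h)^(2 \<times> ('c + 'h) + 'h)" where
  "noise_cov \<tau> \<sigma>1 \<sigma>2 \<sigma>3 =
     (let \<Sigma>1 = diagmat (\<chi> i. (\<sigma>1 $ i)\<^sup>2);
          \<Sigma>2 = diagmat (\<chi> i. (\<sigma>2 $ i)\<^sup>2);
          \<Sigma>5 = diagmat (\<chi> i. (\<sigma>3 $ i)\<^sup>2);
          \<Sigma>3 = block 0 0 0 \<Sigma>5 :: real^('c + 'h)^('c + 'h);
          \<Sigma>4 = vcat 0 \<Sigma>5 :: real^'h^('c + 'h);
          Q11 = \<tau> *\<^sub>R \<Sigma>1 + (\<tau>^3 / 3) *\<^sub>R \<Sigma>2 + (\<tau>^5 / 20) *\<^sub>R \<Sigma>3;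
          Q12 = (\<tau>^2 / 2) *\<^sub>R \<Sigma>2 + (\<tau>^4 / 8) *\<^sub>R \<Sigma>3;
          Q22 = \<tau> *\<^sub>R \<Sigma>2 + (\<tau>^3 / 3) *\<^sub>R \<Sigma>3
      in block
           (vcat2 (hcat2 Q11 Q12) (hcat2 Q12 Q22))
           (vcat2 ((\<tau>^3 / 6) *\<^sub>R \<Sigma>4) ((\<tau>^2 / 2) *\<^sub>R \<Sigma>4))
           (hcat2 ((\<tau>^3 / 6) *\<^sub>R transpose \<Sigma>4) ((\<tau>^2 / 2) *\<^sub>R transpose \<Sigma>4))
           (\<tau> *\<^sub>R \<Sigma>5))"

text \<open>The predicates below speak about single sample paths, that is, the outcome is fixed.\<close>

definition plant ::
    "real \<Rightarrow> real^('c::finite + 'h::finite)^'m::finite \<Rightarrow>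
     (nat \<Rightarrow> real^(2 \<times> ('c + 'h) + 'h)) \<Rightarrow> (nat \<Rightarrow> real^'m) \<Rightarrow>
     (nat \<Rightarrow> real^(2 \<times> ('c + 'h))) \<Rightarrow> (nat \<Rightarrow> real^'h) \<Rightarrow>
     (nat \<Rightarrow> real^('c + 'h)) \<Rightarrow> (nat \<Rightarrow> real^'m) \<Rightarrow> bool" where
  "plant \<tau> V v w x z u y \<longleftrightarrow> (\<forall>k.
     vcat (x (Suc k)) (z (Suc k)) =
       block (Amat \<tau> \<otimes>\<^sub>K mat 1) (col_left (\<beta>mat \<tau> \<otimes>\<^sub>K Jmat)) 0 (mat 1) *v vcat (x k) (z k)
       + vcat (col_left (Bmat \<tau> \<otimes>\<^sub>K mat 1)) 0 *v u k + v k \<and>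
     y k = hcat (row_left (Cmat \<otimes>\<^sub>K V)) 0 *v vcat (x k) (z k) + w k)"


section \<open>Observable canonical decomposition\<close>

definition Vplus :: "real^'n::finite^'m::finite \<Rightarrow> real^'m^'n \<Rightarrow> real^'m^'n" where
  "Vplus V W = W ** matrix_inv (V ** W)"

definition To :: "real^('c::finite + 'h::finite)^'m::finite \<Rightarrow>
    real^(2 \<times> ('c + 'h) + 'h)^(2 \<times> 'm + 'h)" where
  "To V = block (mat 1 \<otimes>\<^sub>K V) 0 0 (mat 1)"

definition \<eta>_o :: "real^('c::finite + 'h::finite)^'m::finite \<Rightarrow>
    real^(2 \<times> ('c + 'h)) \<Rightarrow> real^'h \<Rightarrow> real^(2 \<times> 'm + 'h)" where
  "\<eta>_o V x z = To V *v vcat x z"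

definition \<eta>_unobs :: "real^'n::finite \<Rightarrow> real^(2 \<times> 'n) \<Rightarrow> real^2" where
  "\<eta>_unobs q x = row_right (mat 1 \<otimes>\<^sub>K rowvector q) *v x"

definition \<theta>_unobs :: "real^'n::finite \<Rightarrow> real^(2 \<times> 'n) \<Rightarrow> real" where
  "\<theta>_unobs q x = (Cmat *v \<eta>_unobs q x) $ 1"

definition time_dev :: "real^(2 \<times> 'n::finite) \<Rightarrow> real^'n" where
  "time_dev x = (\<chi> i. x $ (1, i))"

definition Aoo :: "real \<Rightarrow> real^('c::finite + 'h::finite)^'m::finite \<Rightarrow>
    real^(2 \<times> 'm + 'h)^(2 \<times> 'm + 'h)" where
  "Aoo \<tau> V = block (Amat \<tau> \<otimes>\<^sub>K mat 1) (col_left (\<beta>mat \<tau> \<otimes>\<^sub>K (V ** Jmat))) 0 (mat 1)"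

definition Bo :: "real \<Rightarrow> real^('c::finite + 'h::finite)^'m::finite \<Rightarrow>
    real^('c + 'h)^(2 \<times> 'm + 'h)" where
  "Bo \<tau> V = vcat (col_left (Bmat \<tau> \<otimes>\<^sub>K V)) 0"

definition Co :: "real^(2 \<times> 'm::finite + 'h::finite)^'m" where
  "Co = hcat (row_left (Cmat \<otimes>\<^sub>K mat 1)) 0"


section \<open>Steady-state Kalman filter and feedback\<close>

definition innovation_gain :: "real \<Rightarrow> real^(2 \<times> 'm::finite + 'h::finite)^(2 \<times> 'm + 'h) \<Rightarrow>
    real^'m^(2 \<times> 'm + 'h)" where
  "innovation_gain r P =
     P ** transpose Co ** matrix_inv (Co ** P ** transpose Co + r *\<^sub>R mat 1)"

text \<open>
  The Riccati equation may have further solutions that are not positive semidefinite, hence are not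
  covariance matrices.
\<close>

definition steady_prior_cov ::
    "real \<Rightarrow> real^('c::finite + 'h::finite)^'m::finite \<Rightarrow> real \<Rightarrow>
     real^(2 \<times> ('c + 'h) + 'h)^(2 \<times> ('c + 'h) + 'h) \<Rightarrow>
     real^(2 \<times> 'm + 'h)^(2 \<times> 'm + 'h) \<Rightarrow> bool" where
  "steady_prior_cov \<tau> V r Q P \<longleftrightarrow> psd P \<and>
     P = To V ** Q ** transpose (To V) + Aoo \<tau> V ** P ** transpose (Aoo \<tau> V)
       - Aoo \<tau> V ** P ** transpose Co ** matrix_inv (Co ** P ** transpose Co + r *\<^sub>R mat 1)
         ** Co ** P ** transpose (Aoo \<tau> V)"

text \<open>
  \<open>em\<close> and \<open>e\<close> are the prior and the posterior estimate of the observable state; the initial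
  estimate \<open>e 0\<close> is unconstrained and \<open>em 0\<close> is irrelevant.
\<close>

definition kalman_filter ::
    "real \<Rightarrow> real^('c::finite + 'h::finite)^'m::finite \<Rightarrow> real \<Rightarrow>
     real^(2 \<times> 'm + 'h)^(2 \<times> 'm + 'h) \<Rightarrow> (nat \<Rightarrow> real^('c + 'h)) \<Rightarrow> (nat \<Rightarrow> real^'m) \<Rightarrow>
     (nat \<Rightarrow> real^(2 \<times> 'm + 'h)) \<Rightarrow> (nat \<Rightarrow> real^(2 \<times> 'm + 'h)) \<Rightarrow> bool" where
  "kalman_filter \<tau> V r P u y em e \<longleftrightarrow> (\<forall>k.
     em (Suc k) = Aoo \<tau> V *v e k + Bo \<tau> V *v u k \<and>
     e (Suc k) = em (Suc k) + innovation_gain r P *v (y (Suc k) - Co *v em (Suc k)))"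

definition Fmat :: "real \<Rightarrow> real \<Rightarrow> real^2^1" where
  "Fmat \<tau> \<gamma> = vector [vector [\<gamma> / \<tau>, 1]]"

definition feedback ::
    "real \<Rightarrow> real^('c::finite + 'h::finite)^'m::finite \<Rightarrow> real^'m^('c + 'h) \<Rightarrow> real \<Rightarrow>
     (nat \<Rightarrow> real^(2 \<times> 'm + 'h)) \<Rightarrow> (nat \<Rightarrow> real^('c + 'h)) \<Rightarrow> bool" where
  "feedback \<tau> V W \<gamma> e u \<longleftrightarrow> (\<forall>k.
     u k = Vplus V W *v
       (- (hcat (row_left (Fmat \<tau> \<gamma> \<otimes>\<^sub>K mat 1)) ((\<tau> / 2) *\<^sub>R (V ** Jmat)) *v e k)))"

definition closed_loop ::
    "real \<Rightarrow> real^('c::finite + 'h::finite)^'m::finite \<Rightarrow> real^'m^('c + 'h) \<Rightarrow> real \<Rightarrow>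
     real^(2 \<times> 'm + 'h)^(2 \<times> 'm + 'h) \<Rightarrow> real \<Rightarrow>
     (nat \<Rightarrow> real^(2 \<times> ('c + 'h) + 'h)) \<Rightarrow> (nat \<Rightarrow> real^'m) \<Rightarrow>
     (nat \<Rightarrow> real^(2 \<times> ('c + 'h))) \<Rightarrow> (nat \<Rightarrow> real^'h) \<Rightarrow>
     (nat \<Rightarrow> real^('c + 'h)) \<Rightarrow> (nat \<Rightarrow> real^'m) \<Rightarrow>
     (nat \<Rightarrow> real^(2 \<times> 'm + 'h)) \<Rightarrow> (nat \<Rightarrow> real^(2 \<times> 'm + 'h)) \<Rightarrow> bool" where
  "closed_loop \<tau> V W r P \<gamma> v w x z u y em e \<longleftrightarrow>
     plant \<tau> V v w x z u y \<and> kalman_filter \<tau> V r P u y em e \<and> feedback \<tau> V W \<gamma> e u"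

text \<open>
  Closed-loop processes on the probability space \<open>\<Omega>\<close>, driven by the given noise. The initial state
  and the initial estimate are arbitrary integrable random vectors.
\<close>

definition closed_loop_process ::
    "'w measure \<Rightarrow> real \<Rightarrow> real^('c::finite + 'h::finite)^'m::finite \<Rightarrow> real^'m^('c + 'h) \<Rightarrow>
     real \<Rightarrow> real^(2 \<times> 'm + 'h)^(2 \<times> 'm + 'h) \<Rightarrow> real \<Rightarrow>
     (nat \<Rightarrow> 'w \<Rightarrow> real^(2 \<times> ('c + 'h) + 'h)) \<Rightarrow> (nat \<Rightarrow> 'w \<Rightarrow> real^'m) \<Rightarrow>
     (nat \<Rightarrow> 'w \<Rightarrow> real^(2 \<times> ('c + 'h))) \<Rightarrow> (nat \<Rightarrow> 'w \<Rightarrow> real^'h) \<Rightarrow>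
     (nat \<Rightarrow> 'w \<Rightarrow> real^('c + 'h)) \<Rightarrow> (nat \<Rightarrow> 'w \<Rightarrow> real^'m) \<Rightarrow>
     (nat \<Rightarrow> 'w \<Rightarrow> real^(2 \<times> 'm + 'h)) \<Rightarrow> (nat \<Rightarrow> 'w \<Rightarrow> real^(2 \<times> 'm + 'h)) \<Rightarrow> bool" where
  "closed_loop_process \<Omega> \<tau> V W r P \<gamma> v w x z u y em e \<longleftrightarrow>
     integrable \<Omega> (x 0) \<and> integrable \<Omega> (z 0) \<and> integrable \<Omega> (e 0) \<and>
     (\<forall>\<omega>\<in>space \<Omega>. closed_loop \<tau> V W r P \<gamma> (\<lambda>k. v k \<omega>) (\<lambda>k. w k \<omega>)
        (\<lambda>k. x k \<omega>) (\<lambda>k. z k \<omega>) (\<lambda>k. u k \<omega>) (\<lambda>k. y k \<omega>) (\<lambda>k. em k \<omega>) (\<lambda>k. e k \<omega>))"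

end

theory Submission
  imports Defs
begin

text \<open>
  In the coordinates \<open>\<xi> = V p\<close> the control input turns the mean phase recursion into
  \<open>m[k+1] = (1 - \<gamma>) m[k] + H \<mu>[k]\<close>, where \<open>\<mu>\<close> is the mean estimation error of the observable state
  and \<open>p - \<theta> ones = V\<^sup>+ V p\<close>. An exact initial estimate gives \<open>\<mu> = 0\<close>, hence necessity of
  \<open>\<bar>1 - \<gamma>\<bar> < 1\<close>. For sufficiency one needs \<open>\<mu> \<longrightarrow> 0\<close>. The quadratic form of the Riccati solution
  is a Lyapunov function of the transposed error dynamics, so along its orbits the noise covariance
  form and the innovation term vanish asymptotically. The orbits are then asymptotically orbits of the
  transpose of the unipotent matrix \<open>A\<^sub>o\<^sub>o\<close>, and since its fixed vectors are all excited by
  the process noise, they tend to zero.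
\<close>

section \<open>Block calculus\<close>

lemma sum_UNIV_two_times:
  "(\<Sum>k\<in>UNIV. f k) = (\<Sum>i\<in>UNIV. f (1, i)) + (\<Sum>i\<in>UNIV. f (2 :: 2, i))"
  for f :: "2 \<times> 'n::finite \<Rightarrow> 'a::comm_monoid_add"
proof -
  have "(\<Sum>k\<in>UNIV. f k) = (\<Sum>k\<in>UNIV \<times> UNIV. f k)" by simp
  also have "\<dots> = (\<Sum>a\<in>UNIV. \<Sum>i\<in>UNIV. f (a, i))" by (simp add: sum.cartesian_product)
  also have "\<dots> = (\<Sum>i\<in>UNIV. f (1, i)) + (\<Sum>i\<in>UNIV. f (2, i))" by (simp add: sum_2)
  finally show ?thesis .
qed

lemma sum_UNIV_sum:
  "(\<Sum>k\<in>UNIV. f k) = (\<Sum>i\<in>UNIV. f (Inl i)) + (\<Sum>j\<in>UNIV. f (Inr j))"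
  for f :: "'b::finite + 'd::finite \<Rightarrow> 'a::comm_monoid_add"
  by (simp add: UNIV_Plus_UNIV [symmetric] sum.Plus del: UNIV_Plus_UNIV)

lemma vcat_nth [simp]: "vcat X Y $ Inl b = X $ b" "vcat X Y $ Inr d = Y $ d"
  by (simp_all add: vcat_def)

lemma vcat2_nth [simp]: "vcat2 X Y $ (1, i) = X $ i" "vcat2 X Y $ (2, i) = Y $ i"
  by (simp_all add: vcat2_def)

lemma vcat_eq_iff: "X = Y \<longleftrightarrow> upper X = upper Y \<and> lower X = lower Y"
proof
  assume eq: "upper X = upper Y \<and> lower X = lower Y"
  then have "X $ i = Y $ i" for i
    by (cases i) (simp_all add: upper_def lower_def vec_eq_iff)
  then show "X = Y" by (simp add: vec_eq_iff)
qed simp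

lemma upper_vcat [simp]: "upper (vcat X Y) = X"
  and lower_vcat [simp]: "lower (vcat X Y) = Y"
  by (simp_all add: upper_def lower_def vec_eq_iff)

lemma vcat_upper_lower [simp]: "vcat (upper X) (lower X) = X"
  by (simp add: vcat_eq_iff)

text \<open>Together with \<open>vcat2_cases\<close> this splits a state into phase, frequency and
  drift blocks. From then on matrices are handled only through their action on such blocks.\<close>

lemma vcat_cases: obtains a b where "X = vcat a b"
  by (metis vcat_upper_lower)

lemma vcat2_cases:
  obtains a b where "X = vcat2 a b"
proof
  show "X = vcat2 (\<chi> i. X $ (1, i)) (\<chi> i. X $ (2, i))"
    by (simp add: vec_eq_iff forall_2 split_paired_all)
qed

lemma vcat_add: "vcat a b + vcat c d = vcat (a + c) (b + d)"
  and vcat_diff: "vcat a' b' - vcat c' d' = vcat (a' - c') (b' - d')"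
  and vcat_zero: "vcat 0 0 = (0 :: real^('b::finite+'d::finite))"
  for a c :: "real^'b::finite"  and b d :: "real^'d::finite"
  and a' c' :: "real^'b::finite"  and b' d' :: "real^'d::finite"
  by (simp_all add: vcat_eq_iff upper_def lower_def vec_eq_iff)

lemma vcat2_add: "vcat2 a b + vcat2 c d = vcat2 (a + c) (b + d)"
  and vcat2_diff: "vcat2 a b - vcat2 c d = vcat2 (a - c) (b - d)"
  and vcat2_zero: "vcat2 0 0 = (0 :: real^(2 \<times> 'n::finite))"
  for a b c d :: "real^'n::finite"
  by (simp_all add: vcat2_def vec_eq_iff)

lemma inner_vcat [simp]: "vcat a b \<bullet> vcat c d = a \<bullet> c + b \<bullet> d"
  for a c :: "real^'b::finite"  and b d :: "real^'d::finite"
  by (simp add: inner_vec_def sum_UNIV_sum)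

lemma inner_vcat2 [simp]: "vcat2 a b \<bullet> vcat2 c d = a \<bullet> c + b \<bullet> d"
  for a b c d :: "real^'n::finite"
  by (simp add: inner_vec_def sum_UNIV_two_times)

lemma vcat_mult_vec [simp]: "vcat X Y *v u = vcat (X *v u) (Y *v u)"
  by (simp add: vcat_eq_iff upper_def lower_def vec_eq_iff matrix_vector_mult_def)

lemma vcat2_mult_vec [simp]: "vcat2 X Y *v u = vcat2 (X *v u) (Y *v u)"
  by (simp add: vcat2_def vec_eq_iff matrix_vector_mult_def)

lemma hcat_mult_vcat [simp]: "hcat X Y *v vcat a b = X *v a + Y *v b"
  by (simp add: hcat_def vec_eq_iff matrix_vector_mult_def sum_UNIV_sum)

lemma hcat2_mult_vcat2 [simp]: "hcat2 X Y *v vcat2 a b = X *v a + Y *v b"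
  by (simp add: hcat2_def vec_eq_iff matrix_vector_mult_def sum_UNIV_two_times)

lemma block_mult_vcat [simp]:
  "block X11 X12 X21 X22 *v vcat a b = vcat (X11 *v a + X12 *v b) (X21 *v a + X22 *v b)"
  by (simp add: block_def)

section \<open>Kronecker products on block vectors: the left factor mixes the blocks, the right one
  acts inside them\<close>

lemma kron_mult_vcat2:
  "(X \<otimes>\<^sub>K M) *v vcat2 a b = vcat2 (X $ 1 $ 1 *\<^sub>R (M *v a) + X $ 1 $ 2 *\<^sub>R (M *v b))
     (X $ 2 $ 1 *\<^sub>R (M *v a) + X $ 2 $ 2 *\<^sub>R (M *v b))"
  by (simp add: kron_def vec_eq_iff matrix_vector_mult_def sum_UNIV_two_times forall_2
       sum_distrib_left mult_ac split_paired_all)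

lemma col_left_kron_mult:
  "col_left (X \<otimes>\<^sub>K M) *v c = vcat2 (X $ 1 $ 1 *\<^sub>R (M *v c)) (X $ 2 $ 1 *\<^sub>R (M *v c))"
  by (simp add: col_left_def kron_def vec_eq_iff matrix_vector_mult_def forall_2
       sum_distrib_left mult_ac split_paired_all)

lemma row_left_kron_mult:
  "row_left (X \<otimes>\<^sub>K M) *v vcat2 a b = X $ 1 $ 1 *\<^sub>R (M *v a) + X $ 1 $ 2 *\<^sub>R (M *v b)"
  by (simp add: row_left_def kron_def vec_eq_iff matrix_vector_mult_def sum_UNIV_two_times
       sum_distrib_left mult_ac)

lemma row_right_kron_mult:
  fixes X :: "real^2^2"
  shows "row_right (X \<otimes>\<^sub>K rowvector q) *v vcat2 a b =
     vector [X $ 1 $ 1 * (q \<bullet> a) + X $ 1 $ 2 * (q \<bullet> b), X $ 2 $ 1 * (q \<bullet> a) + X $ 2 $ 2 * (q \<bullet> b)]"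
  by (simp add: row_right_def kron_def vec_eq_iff matrix_vector_mult_def sum_UNIV_two_times forall_2
       sum_distrib_left mult_ac rowvector_def inner_vec_def)

text \<open>Serves the coefficient of the drift in the synchronization destination: since
  \<open>rowvector q\<close> is a single row, the drift enters only through the scalar
  \<open>q \<bullet> (M *v c)\<close>.\<close>

lemma col_left_row_right_kron_mult:
  fixes X :: "real^1^2"
  shows "col_left (row_right (X \<otimes>\<^sub>K (rowvector q ** M))) *v c =
     vector [X $ 1 $ 1 * (q \<bullet> (M *v c)), X $ 2 $ 1 * (q \<bullet> (M *v c))]"
proof -
  have *: "(\<Sum>j\<in>UNIV. (rowvector q ** M :: real^_^1) $ 1 $ j * c $ j) = q \<bullet> (M *v c)"
  proof -
    have "(\<Sum>j\<in>UNIV. (rowvector q ** M :: real^_^1) $ 1 $ j * c $ j) = ((rowvector q ** M :: real^_^1) *v c) $ 1"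
      by (simp add: matrix_vector_mult_def)
    also have "\<dots> = ((rowvector q :: real^_^1) *v (M *v c)) $ 1" by (simp add: matrix_vector_mul_assoc)
    also have "\<dots> = q \<bullet> (M *v c)"
      by (subst matrix_vector_mult_def) (simp add: rowvector_def inner_vec_def)
    finally show ?thesis .
  qed
  show ?thesis
    by (simp add: col_left_def row_right_def kron_def vec_eq_iff forall_2 * [symmetric]
       matrix_vector_mult_def [of "\<chi> i j. _ i j"] sum_distrib_left mult.assoc)
qed

section \<open>The quadratic form of the process noise covariance\<close>

lemma scaled_mult_vec: "(c *\<^sub>R X) *v y = c *\<^sub>R (X *v y)"
  for X :: "real^'n::finite^'m::finite"
  by (simp add: scaleR_matrix_vector_assoc)

lemma diagmat_mult_vec: "diagmat d *v x = (\<chi> i. d $ i * x $ i)"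
  by (simp add: diagmat_def vec_eq_iff matrix_vector_mult_def if_distrib [of "\<lambda>t. t * _"] cong: if_cong)

text \<open>A vector without phase component meets only the lower right part of the covariance. A
  frequency component supported on the cesium clocks is orthogonal to \<open>\<Sigma>3\<close> and
  \<open>\<Sigma>4\<close>, so the cross terms with the drift vanish too. The vectors to be tested
  for excitation later have this shape.\<close>

lemma noise_cov_form:
  fixes a :: "real^('c::finite + 'h::finite)"
  assumes "\<And>j. a $ Inr j = 0"
  shows "vcat (vcat2 0 a) c \<bullet> (noise_cov \<tau> \<sigma>1 \<sigma>2 \<sigma>3 *v vcat (vcat2 0 a) c) =
    \<tau> * (\<Sum>i\<in>UNIV. (\<sigma>2 $ Inl i)\<^sup>2 * (a $ Inl i)\<^sup>2) + \<tau> * (\<Sum>j\<in>UNIV. (\<sigma>3 $ j)\<^sup>2 * (c $ j)\<^sup>2)"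
proof -
  define b where "b = upper a"
  have a: "a = vcat b 0" using assms by (simp add: vcat_eq_iff b_def lower_def vec_eq_iff)
  have 1: "diagmat d *v vcat b 0 = vcat (\<chi> i. d $ Inl i * b $ i) 0" for d :: "real^('c + 'h)"
    by (simp add: diagmat_mult_vec vcat_eq_iff upper_def lower_def vec_eq_iff)
  \<comment> \<open>Removes the lower left block of the covariance, where the transpose of
    \<open>\<Sigma>4\<close> acts on \<open>a\<close>.\<close>
  have 2: "vcat b 0 v* vcat 0 X = 0" for X :: "real^'h^'h"
    by (simp add: vector_matrix_mult_def vec_eq_iff sum_UNIV_sum)
  show ?thesis
    by (simp add: a noise_cov_def Let_def scaled_mult_vec matrix_vector_mult_add_rdistrib 1 2
       diagmat_mult_vec inner_add_right vector_scaleR_matrix_ac)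
      (simp add: inner_vec_def sum_UNIV_sum power2_eq_square mult_ac)
qed

section \<open>Stability of the Riccati error dynamics\<close>

lemma matrix_vector_mult_tendsto_zero:
  fixes M :: "real^'n::finite^'m::finite"
  assumes "X \<longlonglongrightarrow> 0" shows "(\<lambda>k. M *v X k) \<longlonglongrightarrow> 0"
  using bounded_linear.tendsto [OF matrix_vector_mul_bounded_linear assms, of M] by simp

lemma linear_vector_matrix_mult: "linear (\<lambda>y. y v* M)" for M :: "real^'n::finite^'m::finite"
  using matrix_vector_mul_linear [of "transpose M"] by simp

section \<open>Positive semidefinite forms\<close>

lemma psd_inner_commute: "psd S \<Longrightarrow> (S *v x) \<bullet> y = x \<bullet> (S *v y)"
  by (metis dot_lmul_matrix psd_def transpose_matrix_vector)

text \<open>Replaces a matrix square root: the form is nonnegative at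
  \<open>y - (1 / K) *\<^sub>R (S *v y)\<close>, with \<open>K\<close> a bound for the operator norm
  of \<open>S\<close>, and expanding it gives the estimate.\<close>

lemma psd_norm_bound:
  assumes "psd S"
  obtains K where "K > 0" "\<And>y. (norm (S *v y))\<^sup>2 \<le> K * (y \<bullet> (S *v y))"
proof -
  obtain K where K: "K > 0" "\<And>x. norm (S *v x) \<le> K * norm x"
    using bounded_linear.pos_bounded [OF matrix_vector_mul_bounded_linear [of S]]
    by (metis mult.commute)
  have "(norm (S *v y))\<^sup>2 \<le> K * (y \<bullet> (S *v y))" for y
  proof -
    define s where "s = S *v y"
    have "s \<bullet> (S *v s) \<le> norm s * norm (S *v s)" by (rule norm_cauchy_schwarz)
    also have "\<dots> \<le> norm s * (K * norm s)" by (intro mult_left_mono K norm_ge_zero)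
    finally have b: "s \<bullet> (S *v s) \<le> K * (norm s)\<^sup>2" by (simp add: power2_eq_square mult_ac)
    \<comment> \<open>The factor \<open>1 / K\<close> minimises the upper bound \<open>y \<bullet> s
      - 2 * t * (norm s)\<^sup>2 + t\<^sup>2 * K * (norm s)\<^sup>2\<close> over
      \<open>t\<close>.\<close>
    have "0 \<le> (y - (1 / K) *\<^sub>R s) \<bullet> (S *v (y - (1 / K) *\<^sub>R s))"
      using assms by (simp add: psd_def)
    also have "\<dots> = y \<bullet> s - 2 / K * (s \<bullet> s) + (1 / K)\<^sup>2 * (s \<bullet> (S *v s))"
      using psd_inner_commute [OF assms, of y s]
      by (simp add: matrix_vector_mult_diff_distrib matrix_vector_mult_scaleR inner_diff_left
          inner_diff_right s_def [symmetric] power2_eq_square algebra_simps inner_commute)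
    also have "\<dots> \<le> y \<bullet> s - 2 / K * (norm s)\<^sup>2 + (1 / K)\<^sup>2 * (K * (norm s)\<^sup>2)"
      using mult_left_mono [OF b, of "(1 / K)\<^sup>2"] by (simp add: power2_norm_eq_inner)
    also have "\<dots> = y \<bullet> s - (norm s)\<^sup>2 / K" using K by (simp add: field_simps power2_eq_square)
    finally show ?thesis using K by (simp add: s_def field_simps)
  qed
  with K that show ?thesis by blast
qed

lemma psd_tendsto_zero:
  assumes "psd S" "(\<lambda>k. y k \<bullet> (S *v y k)) \<longlonglongrightarrow> 0"
  shows "(\<lambda>k. S *v y k) \<longlonglongrightarrow> 0"
proof -
  obtain K where "K > 0" and K: "\<And>y. (norm (S *v y))\<^sup>2 \<le> K * (y \<bullet> (S *v y))"
    using psd_norm_bound [OF assms(1)] by blast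
  have "(\<lambda>k. K * (y k \<bullet> (S *v y k))) \<longlonglongrightarrow> 0" using tendsto_mult_right_zero [OF assms(2)] .
  then have "(\<lambda>k. (norm (S *v y k))\<^sup>2) \<longlonglongrightarrow> 0"
    by (rule tendsto_sandwich [OF always_eventually always_eventually tendsto_const, rotated 2]) (auto intro: K)
  then show ?thesis by (simp add: tendsto_norm_zero_iff)
qed

text \<open>On a kernel vector the form of \<open>S\<close> and \<open>r * (x \<bullet> x)\<close>
  are nonnegative with sum zero. Applied to the innovation covariance.\<close>

lemma psd_add_scaled_mat_invertible:
  fixes S :: "real^'m::finite^'m"
  assumes "psd S" "r > 0" shows "invertible (S + r *\<^sub>R mat 1)"
proof -
  have "x = 0" if "(S + r *\<^sub>R mat 1) *v x = 0" for x
  proof -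
    have "x \<bullet> (S *v x) + r * (x \<bullet> x) = x \<bullet> ((S + r *\<^sub>R mat 1) *v x)"
      by (simp add: matrix_vector_mult_add_rdistrib scaleR_matrix_vector_assoc [symmetric] inner_add_right)
    also have "\<dots> = 0" using that by simp
    finally have "r * (x \<bullet> x) \<le> 0" using assms by (simp add: psd_def add_nonneg_eq_0_iff)
    then show ?thesis using assms(2) inner_ge_zero [of x] by (simp add: mult_le_0_iff order_antisym)
  qed
  then show ?thesis by (simp add: invertible_left_inverse matrix_left_invertible_ker)
qed

lemma psd_congruence:
  assumes "psd S" shows "psd (C ** S ** transpose C)"
  using assms by (auto simp: psd_def matrix_transpose_mul matrix_mul_assoc
      matrix_vector_mul_assoc [symmetric] dot_lmul_matrix [symmetric])

lemma matrix_inv_right: "invertible A \<Longrightarrow> A ** matrix_inv A = mat 1"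
  and matrix_inv_left: "invertible A \<Longrightarrow> matrix_inv A ** A = mat 1"
  for A :: "real^'n::finite^'m::finite"
  unfolding invertible_def matrix_inv_def by (rule someI2_ex, simp, simp)+

text \<open>
  The completion of squares behind the Joseph form of the covariance update; it exhibits
  \<open>y \<mapsto> y \<bullet> P y\<close> as a Lyapunov function of the transposed error dynamics.
\<close>

lemma riccati_lyapunov:
  fixes A Q P :: "real^'n::finite^'n" and C :: "real^'n^'m::finite" and y :: "real^'n" and r :: real
  defines "S \<equiv> C ** P ** transpose C + r *\<^sub>R mat 1"
  defines "L \<equiv> P ** transpose C ** matrix_inv S"
  assumes "r > 0" "psd P"
    and P: "P = Q + A ** P ** transpose A
              - A ** P ** transpose C ** matrix_inv S ** C ** P ** transpose A"
  shows "y \<bullet> (P *v y) = (let y' = y v* (A ** (mat 1 - L ** C)); g = y v* (A ** L)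
           in y' \<bullet> (P *v y') + y \<bullet> (Q *v y) + r * (g \<bullet> g))"
proof -
  define x where "x = y v* A"
  define g where "g = x v* L"
  have inv: "invertible S"
    unfolding S_def by (intro psd_add_scaled_mat_invertible psd_congruence assms)
  have symS: "transpose S = S"
    using psd_congruence [OF \<open>psd P\<close>, of C]
    by (simp add: S_def psd_def transpose_def mat_def vec_eq_iff)
  \<comment> \<open>The transpose of the gain equation \<open>L ** S = P ** transpose C\<close>. It
    makes \<open>g\<close> the solution of a linear system with matrix \<open>S\<close>.\<close>
  have "S ** transpose L = C ** P"
  proof -
    have "S ** transpose L = transpose (matrix_inv S ** S) ** C ** P"
      using \<open>psd P\<close> by (simp add: L_def matrix_transpose_mul matrix_mul_assoc psd_def symS)
    then show ?thesis by (simp add: matrix_inv_left inv transpose_mat)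
  qed
  then have Sg: "S *v g = C *v (P *v x)"
    by (metis g_def matrix_vector_mul_assoc transpose_matrix_vector)
  then have gS: "g = matrix_inv S *v (C *v (P *v x))"
    by (metis inv matrix_inv_left matrix_vector_mul_assoc matrix_vector_mul_lid)
  have "y \<bullet> (P *v y) = y \<bullet> (Q *v y) + x \<bullet> (P *v x) - x \<bullet> (P *v (g v* C))"
    by (subst P) (simp add: gS matrix_vector_mult_diff_rdistrib matrix_vector_mult_add_rdistrib
        matrix_vector_mul_assoc [symmetric] x_def inner_add_right inner_diff_right dot_lmul_matrix)
  also have x_g: "x \<bullet> (P *v (g v* C)) = g \<bullet> (S *v g)"
    by (metis Sg psd_inner_commute [OF \<open>psd P\<close>] dot_lmul_matrix inner_commute)
  finally have 1: "y \<bullet> (P *v y) = y \<bullet> (Q *v y) + x \<bullet> (P *v x) - g \<bullet> (S *v g)" .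
  have y': "y v* (A ** (mat 1 - L ** C)) = x - g v* C"
    by (simp add: vector_matrix_mul_assoc [symmetric] x_def g_def vector_matrix_mult_diff_rdistrib)
  have g: "y v* (A ** L) = g"
    by (simp add: vector_matrix_mul_assoc x_def g_def)
  \<comment> \<open>Both cross terms equal \<open>g \<bullet> (S *v g)\<close>. By the definition of
    \<open>S\<close> the last term returns one of them, short of \<open>r * (g \<bullet> g)\<close>,
    which is the extra term of the claim.\<close>
  have "(x - g v* C) \<bullet> (P *v (x - g v* C)) = x \<bullet> (P *v x) - 2 * (g \<bullet> (S *v g)) + (g v* C) \<bullet> (P *v (g v* C))"
    using x_g psd_inner_commute [OF \<open>psd P\<close>, of "g v* C" x]
    by (simp add: matrix_vector_mult_diff_distrib inner_diff_left inner_diff_right inner_commute)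
  moreover have "g \<bullet> (S *v g) = (g v* C) \<bullet> (P *v (g v* C)) + r * (g \<bullet> g)"
    by (simp add: S_def matrix_vector_mult_add_rdistrib inner_add_right dot_lmul_matrix
        matrix_vector_mul_assoc [symmetric] scaleR_matrix_vector_assoc [symmetric])
  ultimately show ?thesis using 1 unfolding y' g Let_def by linarith
qed

lemma vector_matrix_mult_tendsto_zero:
  fixes M :: "real^'n::finite^'m::finite"
  assumes "X \<longlonglongrightarrow> 0" shows "(\<lambda>k. X k v* M) \<longlonglongrightarrow> 0"
  using matrix_vector_mult_tendsto_zero [OF assms, of "transpose M"] by simp

text \<open>
  Along the sequence, \<open>Q D\<^sup>j y \<longlongrightarrow> 0\<close> for every \<open>j\<close>. Since \<open>y \<mapsto> (D y, Q y)\<close> is injective, hence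
  bounded below, \<open>D\<^sup>j\<^sup>+\<^sup>1 y \<longlongrightarrow> 0\<close> implies \<open>D\<^sup>j y \<longlongrightarrow> 0\<close>; the descent starts at \<open>D\<^sup>n = 0\<close>.
\<close>

lemma unipotent_dual_tendsto_zero:
  fixes A Q :: "real^'n::finite^'n" and y :: "nat \<Rightarrow> real^'n"
  defines "D \<equiv> A - mat 1"
  assumes nil: "\<And>y. ((\<lambda>y. y v* D) ^^ n) y = 0"
    and ker: "\<And>y. y v* D = 0 \<Longrightarrow> Q *v y = 0 \<Longrightarrow> y = 0"
    and Q: "(\<lambda>k. Q *v y k) \<longlonglongrightarrow> 0"
    and step: "(\<lambda>k. y (Suc k) - y k v* A) \<longlonglongrightarrow> 0"
  shows "y \<longlonglongrightarrow> 0"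
proof -
  define T where "T j = (\<lambda>y. y v* D) ^^ j" for j
  have T0 [simp]: "T 0 y = y" and TS [simp]: "T (Suc j) y = T j y v* D" for j y
    by (simp_all add: T_def)
  have lin: "linear (T j)" for j
  proof (induction j)
    case (Suc j)
    have "T (Suc j) = (\<lambda>y. y v* D) \<circ> T j" by (simp add: fun_eq_iff)
    with linear_compose [OF Suc linear_vector_matrix_mult [of D]] show ?case by (simp only:)
  qed (simp add: T_def linear_iff)
  have T_lim: "(\<lambda>k. T j (X k)) \<longlonglongrightarrow> 0" if "X \<longlonglongrightarrow> 0" for j X
    using bounded_linear.tendsto [OF linear_conv_bounded_linear [THEN iffD1, OF lin] that, of j] lin
    by (simp add: linear_0)
  have TSr: "T (Suc j) y = T j (y v* A) - T j y" for j y
  proof -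
    have "T (Suc j) y = T j (y v* D)" by (simp add: T_def funpow_Suc_right del: funpow.simps(2))
    then show ?thesis
      by (simp add: D_def vector_matrix_mult_diff_rdistrib linear_diff [OF lin])
  qed
  \<comment> \<open>Since \<open>D = A - mat 1\<close>, \<open>T (Suc j) (y k)\<close> is the
    difference of \<open>T j\<close> at \<open>y k v* A\<close> and at \<open>y k\<close>. The
    former argument is \<open>y (Suc k)\<close> up to a null sequence, so the induction hypothesis
    applies to both terms.\<close>
  have QT: "(\<lambda>k. Q *v T j (y k)) \<longlonglongrightarrow> 0" for j
  proof (induction j)
    case (Suc j)
    have "(\<lambda>k. Q *v T j (y (Suc k)) - Q *v T j (y (Suc k) - y k v* A) - Q *v T j (y k)) \<longlonglongrightarrow> 0 - 0 - 0"
      by (intro tendsto_diff Suc matrix_vector_mult_tendsto_zero T_lim step LIMSEQ_Suc)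
    moreover have "Q *v T j (y (Suc k)) - Q *v T j (y (Suc k) - y k v* A) - Q *v T j (y k) = Q *v T (Suc j) (y k)" for k
      by (simp only: TSr linear_diff [OF lin] matrix_vector_mult_diff_distrib) simp
    ultimately show ?case by simp
  qed (simp add: Q)
  let ?K = "\<lambda>y. (y v* D, Q *v y)"
  have "linear ?K"
    by (intro linearI) (simp_all add: vector_matrix_left_distrib matrix_vector_right_distrib
      scaleR_vector_matrix_assoc matrix_vector_mult_scaleR)
  moreover have "inj ?K"
    using linear_injective_0 [OF \<open>linear ?K\<close>] ker unfolding zero_prod_def by blast
  ultimately obtain B where "B > 0" and B: "\<And>y. B * norm y \<le> norm (?K y)"
    using linear_inj_bounded_below_pos by blast
  \<comment> \<open>The power of \<open>D\<close> goes down as \<open>j\<close> goes up. Truncated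
    subtraction keeps it at zero from \<open>j = n\<close> on, which is why the inductive step
    distinguishes \<open>j < n\<close>; the instance \<open>j = n\<close> is \<open>y\<close>
    itself.\<close>
  have "(\<lambda>k. T (n - j) (y k)) \<longlonglongrightarrow> 0" for j
  proof (induction j)
    case 0
    then show ?case using nil by (simp add: T_def)
  next
    case (Suc j)
    show ?case
    proof (cases "j < n")
      case True
      define i where "i = n - Suc j"
      have "n - j = Suc i" using True by (simp add: i_def)
      with Suc have "(\<lambda>k. ?K (T i (y k))) \<longlonglongrightarrow> (0, 0)"
        using QT by (intro tendsto_Pair) simp_all
      then have "(\<lambda>k. norm (?K (T i (y k))) / B) \<longlonglongrightarrow> 0"
        by (intro tendsto_divide_zero tendsto_norm_zero) (simp only: zero_prod_def)
      then have "(\<lambda>k. T i (y k)) \<longlonglongrightarrow> 0"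
        by (rule Lim_null_comparison [rotated])
           (use B \<open>B > 0\<close> in \<open>auto simp: field_simps intro!: always_eventually\<close>)
      then show ?thesis by (simp add: i_def)
    qed (use Suc in simp)
  qed
  from this [of n] show ?thesis by simp
qed

text \<open>By duality it suffices that all orbits of the transposed error dynamics tend to zero.
  \<open>P\<close> is only semidefinite, so decay of its form would not control the orbit; instead
  the decrements of the form are exploited, which bound the noise form and the innovation term and
  lead to \<open>unipotent_dual_tendsto_zero\<close>.\<close>

lemma riccati_error_dynamics_tendsto_zero:
  fixes A Q P :: "real^'n::finite^'n" and C :: "real^'n^'m::finite" and r :: real
  defines "S \<equiv> C ** P ** transpose C + r *\<^sub>R mat 1"
  defines "L \<equiv> P ** transpose C ** matrix_inv S"
  assumes "r > 0" "psd P" "psd Q"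
    and P: "P = Q + A ** P ** transpose A
              - A ** P ** transpose C ** matrix_inv S ** C ** P ** transpose A"
    and nil: "\<And>y. ((\<lambda>y. y v* (A - mat 1)) ^^ n) y = 0"
    and ker: "\<And>y. y v* (A - mat 1) = 0 \<Longrightarrow> Q *v y = 0 \<Longrightarrow> y = 0"
    and d: "\<And>k. d (Suc k) = (A ** (mat 1 - L ** C)) *v d k"
  shows "d \<longlonglongrightarrow> 0"
proof -
  define M where "M = A ** (mat 1 - L ** C)"
  have dual: "(\<lambda>k. ((\<lambda>y. y v* M) ^^ k) b) \<longlonglongrightarrow> 0" for b
  proof -
    define y where "y k = ((\<lambda>y. y v* M) ^^ k) b" for k
    define g where "g k = y k v* (A ** L)" for k
    define f where "f k = y k \<bullet> (P *v y k)" for k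
    have f: "f k = f (Suc k) + y k \<bullet> (Q *v y k) + r * (g k \<bullet> g k)" for k
      using riccati_lyapunov [OF \<open>r > 0\<close> \<open>psd P\<close> P [unfolded S_def], of "y k"]
      by (simp add: f_def g_def y_def M_def L_def S_def Let_def)
    have nn: "0 \<le> f k" "0 \<le> y k \<bullet> (Q *v y k)" "0 \<le> r * (g k \<bullet> g k)" for k
      using \<open>psd P\<close> \<open>psd Q\<close> \<open>r > 0\<close> by (auto simp: psd_def f_def)
    have gap: "y k \<bullet> (Q *v y k) \<le> f k - f (Suc k)" "r * (g k \<bullet> g k) \<le> f k - f (Suc k)" for k
      using f [of k] nn [of k] by linarith+
    \<comment> \<open>A decreasing sequence bounded below by zero converges, so its decrements tend
      to zero; they dominate both nonnegative terms in \<open>gap\<close>.\<close>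
    have "decseq f"
      using gap(1) nn(2) by (intro decseq_SucI) (meson diff_ge_0_iff_ge order_trans)
    then obtain l where l: "f \<longlonglongrightarrow> l" using decseq_convergent nn(1) by blast
    then have diff: "(\<lambda>k. f k - f (Suc k)) \<longlonglongrightarrow> 0" using tendsto_diff [OF l LIMSEQ_Suc [OF l]] by simp
    have "(\<lambda>k. y k \<bullet> (Q *v y k)) \<longlonglongrightarrow> 0"
      by (rule tendsto_sandwich [OF always_eventually always_eventually tendsto_const diff])
         (simp_all add: gap nn)
    then have Qy: "(\<lambda>k. Q *v y k) \<longlonglongrightarrow> 0" by (rule psd_tendsto_zero [OF \<open>psd Q\<close>])
    have "(\<lambda>k. r * (g k \<bullet> g k)) \<longlonglongrightarrow> 0"
      by (rule tendsto_sandwich [OF always_eventually always_eventually tendsto_const diff])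
         (simp_all add: gap nn)
    then have "(\<lambda>k. (norm (g k))\<^sup>2) \<longlonglongrightarrow> 0"
      using tendsto_mult_left_iff [of r "\<lambda>k. g k \<bullet> g k" 0 sequentially] \<open>r > 0\<close> by (simp add: power2_norm_eq_inner)
    then have "g \<longlonglongrightarrow> 0" by (simp add: tendsto_norm_zero_iff)
    then have "(\<lambda>k. - (g k v* C)) \<longlonglongrightarrow> 0"
      using tendsto_minus [OF vector_matrix_mult_tendsto_zero [of g C]] by simp
    \<comment> \<open>The filter correction changes the transposed dynamics exactly by
      \<open>g k v* C\<close>, so a vanishing \<open>g\<close> leaves an asymptotic orbit of the
      transpose of \<open>A\<close>.\<close>
    moreover have "y (Suc k) - y k v* A = - (g k v* C)" for k
      by (simp add: y_def g_def M_def vector_matrix_mul_assoc [symmetric] vector_matrix_mult_diff_rdistrib)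
    ultimately have "(\<lambda>k. y (Suc k) - y k v* A) \<longlonglongrightarrow> 0" by simp
    with nil ker Qy have "y \<longlonglongrightarrow> 0" by (rule unipotent_dual_tendsto_zero)
    then show ?thesis by (simp add: y_def [abs_def])
  qed
  \<comment> \<open>Moves the powers of \<open>M\<close> to the other side of the inner product;
    with \<open>b\<close> a unit vector this gives the entries of \<open>d k\<close>.\<close>
  have *: "b \<bullet> d k = ((\<lambda>y. y v* M) ^^ k) b \<bullet> d 0" for b k
    by (induction k arbitrary: b)
       (simp_all add: d M_def [symmetric] dot_lmul_matrix [symmetric] funpow_Suc_right del: funpow.simps(2))
  show ?thesis
  proof (rule vec_tendstoI)
    fix i
    have "(\<lambda>k. ((\<lambda>y. y v* M) ^^ k) (axis i 1) \<bullet> d 0) \<longlonglongrightarrow> 0"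
      using tendsto_inner [OF dual tendsto_const] by fastforce
    then have "(\<lambda>k. axis i 1 \<bullet> d k) \<longlonglongrightarrow> 0"
      by (subst *)
    then show "(\<lambda>k. d k $ i) \<longlonglongrightarrow> 0 $ i" by (simp add: inner_axis')
  qed
qed

section \<open>The system matrices\<close>

lemma Amat_nth [simp]:
  "Amat \<tau> $ 1 $ 1 = 1" "Amat \<tau> $ 1 $ 2 = \<tau>" "Amat \<tau> $ 2 $ 1 = 0" "Amat \<tau> $ 2 $ 2 = 1"
  and \<beta>mat_nth [simp]: "\<beta>mat \<tau> $ 1 $ 1 = \<tau>\<^sup>2 / 2" "\<beta>mat \<tau> $ 2 $ 1 = \<tau>"
  and Bmat_nth [simp]: "Bmat \<tau> $ 1 $ 1 = \<tau>" "Bmat \<tau> $ 2 $ 1 = 1"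
  and Cmat_nth [simp]: "Cmat $ 1 $ 1 = 1" "Cmat $ 1 $ 2 = 0"
  and Fmat_nth [simp]: "Fmat \<tau> \<gamma> $ 1 $ 1 = \<gamma> / \<tau>" "Fmat \<tau> \<gamma> $ 1 $ 2 = 1"
  by (simp_all add: Amat_def \<beta>mat_def Bmat_def Cmat_def Fmat_def vector_1)

lemma mat_nth_2 [simp]:
  "mat c $ (1 :: 2) $ 1 = c" "mat c $ (1 :: 2) $ 2 = 0" "mat c $ (2 :: 2) $ 1 = 0" "mat c $ (2 :: 2) $ 2 = c"
  by (simp_all add: mat_def)

lemma Aoo_mult [simp]:
  "Aoo \<tau> V *v vcat (vcat2 a b) c =
     vcat (vcat2 (a + \<tau> *\<^sub>R b + (\<tau>\<^sup>2 / 2) *\<^sub>R (V *v (Jmat *v c))) (b + \<tau> *\<^sub>R (V *v (Jmat *v c)))) c"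
  by (simp add: Aoo_def kron_mult_vcat2 col_left_kron_mult vcat2_add matrix_vector_mul_assoc)

lemma To_mult [simp]: "To V *v vcat (vcat2 a b) c = vcat (vcat2 (V *v a) (V *v b)) c"
  by (simp add: To_def kron_mult_vcat2)

lemma Bo_mult [simp]: "Bo \<tau> V *v u = vcat (vcat2 (\<tau> *\<^sub>R (V *v u)) (V *v u)) 0"
  by (simp add: Bo_def col_left_kron_mult)

lemma Co_mult [simp]: "Co *v vcat (vcat2 a b) c = a"
  by (simp add: Co_def row_left_kron_mult)

lemma \<eta>_o_vcat2 [simp]: "\<eta>_o V (vcat2 a b) c = vcat (vcat2 (V *v a) (V *v b)) c"
  by (simp add: \<eta>_o_def)

lemma \<eta>_unobs_vcat2 [simp]: "\<eta>_unobs q (vcat2 a b) = vector [q \<bullet> a, q \<bullet> b]"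
  by (simp add: \<eta>_unobs_def row_right_kron_mult)

lemma time_dev_vcat2 [simp]: "time_dev (vcat2 a b) = a"
  by (simp add: time_dev_def vec_eq_iff)

lemma \<theta>_unobs_eq: "\<theta>_unobs q x = q \<bullet> time_dev x"
  by (cases x rule: vcat2_cases)
     (simp add: \<theta>_unobs_def matrix_vector_mult_def sum_2)

lemma Co_\<eta>_o: "Co *v \<eta>_o V x z = V *v time_dev x"
  by (cases x rule: vcat2_cases) simp

text \<open>\<open>To V\<close> is known through its action on blocks, so its transpose is
  identified by testing against all vectors.\<close>

lemma vec_To: "vcat (vcat2 a b) c v* To V = vcat (vcat2 (a v* V) (b v* V)) c"
proof -
  have "(vcat (vcat2 a b) c v* To V) \<bullet> s = vcat (vcat2 (a v* V) (b v* V)) c \<bullet> s" for s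
  proof -
    obtain t f z where "s = vcat (vcat2 t f) z" by (metis vcat_cases vcat2_cases)
    then show ?thesis by (simp add: dot_lmul_matrix)
  qed
  then show ?thesis using vector_eq_rdot by blast
qed

lemma Aoo_minus_one_mult:
  "(Aoo \<tau> V - mat 1) *v vcat (vcat2 a b) c =
     vcat (vcat2 (\<tau> *\<^sub>R b + (\<tau>\<^sup>2 / 2) *\<^sub>R (V *v (Jmat *v c))) (\<tau> *\<^sub>R (V *v (Jmat *v c)))) 0"
  by (simp add: matrix_vector_mult_diff_rdistrib vcat_diff vcat2_diff)

text \<open>\<open>Aoo \<tau> V - mat 1\<close> sends drift to frequency and phase, frequency to
  phase, and phase to zero. Its third power therefore vanishes, and so does that of its
  transpose.\<close>

lemma Aoo_unipotent: "((\<lambda>y. y v* (Aoo \<tau> V - mat 1)) ^^ 3) y = 0"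
proof -
  let ?D = "Aoo \<tau> V - mat 1"
  have "?D *v (?D *v (?D *v s)) = 0" for s
  proof -
    obtain t f z where "s = vcat (vcat2 t f) z" by (metis vcat_cases vcat2_cases)
    then show ?thesis by (simp add: Aoo_minus_one_mult vcat2_zero vcat_zero)
  qed
  then have "((\<lambda>y. y v* ?D) ^^ 3) y \<bullet> s = 0 \<bullet> s" for s
    by (simp add: eval_nat_numeral dot_lmul_matrix)
  then show ?thesis using vector_eq_rdot by blast
qed

text \<open>
  A fixed vector of the transpose has no phase component, and its frequency component, pulled back
  along \<open>V\<close>, vanishes on the maser clocks. Hence only the random walk frequency noise of the cesium
  clocks matters, and \<open>\<sigma>2\<close> may vanish on the masers.
\<close>

lemma noise_excites_observable_modes:
  fixes V :: "real^('c::finite + 'h::finite)^'m::finite"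
  assumes "\<tau> > 0" "\<And>i. \<sigma>2 $ Inl i > 0" "\<And>j. \<sigma>3 $ j > 0"
    and V: "\<And>a. a v* V = 0 \<Longrightarrow> a = 0"
    and y: "y v* (Aoo \<tau> V - mat 1) = 0"
    and Q: "(To V ** noise_cov \<tau> \<sigma>1 \<sigma>2 \<sigma>3 ** transpose (To V)) *v y = 0"
  shows "y = 0"
proof -
  obtain a b c where abc: "y = vcat (vcat2 a b) c" by (metis vcat_cases vcat2_cases)
  have orth: "y \<bullet> ((Aoo \<tau> V - mat 1) *v s) = 0" for s
    using y by (simp add: dot_lmul_matrix [symmetric])
  \<comment> \<open>The test vector with frequency block \<open>a\<close> and zeros elsewhere yields
    \<open>\<tau> * (a \<bullet> a) = 0\<close>.\<close>
  have a: "a = 0"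
    using orth [of "vcat (vcat2 0 a) 0"] \<open>\<tau> > 0\<close> by (simp add: abc Aoo_minus_one_mult)
  \<comment> \<open>With \<open>a = 0\<close>, a pure drift \<open>d\<close> sees only the frequency
    row; unit vectors for \<open>d\<close> then read off the maser entries of
    \<open>b v* V\<close>.\<close>
  have "(b v* V) \<bullet> (Jmat *v d) = 0" for d
    using orth [of "vcat (vcat2 0 0) d"] \<open>\<tau> > 0\<close>
    by (simp add: abc a Aoo_minus_one_mult dot_lmul_matrix)
  from this [of "axis _ 1"] have bV: "(b v* V) $ Inr j = 0" for j
    by (simp add: inner_vec_def sum_UNIV_sum Jmat_def axis_def if_distrib cong: if_cong)
  have "0 = y \<bullet> ((To V ** noise_cov \<tau> \<sigma>1 \<sigma>2 \<sigma>3 ** transpose (To V)) *v y)"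
    using Q by simp
  also have "\<dots> = (y v* To V) \<bullet> (noise_cov \<tau> \<sigma>1 \<sigma>2 \<sigma>3 *v (y v* To V))"
    by (simp add: matrix_vector_mul_assoc [symmetric] dot_lmul_matrix)
  also have "y v* To V = vcat (vcat2 0 (b v* V)) c"
    by (simp add: abc a vec_To)
  finally have "\<tau> * (\<Sum>i\<in>UNIV. (\<sigma>2 $ Inl i)\<^sup>2 * ((b v* V) $ Inl i)\<^sup>2) + \<tau> * (\<Sum>j\<in>UNIV. (\<sigma>3 $ j)\<^sup>2 * (c $ j)\<^sup>2) = 0"
    using noise_cov_form [of "b v* V" c \<tau> \<sigma>1 \<sigma>2 \<sigma>3] bV by simp
  then have "(\<Sum>i\<in>UNIV. (\<sigma>2 $ Inl i)\<^sup>2 * ((b v* V) $ Inl i)\<^sup>2) + (\<Sum>j\<in>UNIV. (\<sigma>3 $ j)\<^sup>2 * (c $ j)\<^sup>2) = 0"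
    using \<open>\<tau> > 0\<close> unfolding distrib_left [symmetric] by simp
  then have "(\<sigma>2 $ Inl i)\<^sup>2 * ((b v* V) $ Inl i)\<^sup>2 = 0" "(\<sigma>3 $ j)\<^sup>2 * (c $ j)\<^sup>2 = 0" for i j
    by (simp_all add: add_nonneg_eq_0_iff sum_nonneg sum_nonneg_eq_0_iff)
  then have "(b v* V) $ Inl i = 0" "c $ j = 0" for i j
    using assms(2) [of i] assms(3) [of j] by (auto simp: less_le)
  with bV have "b v* V = 0" "c = 0" by (simp_all add: vcat_eq_iff upper_def lower_def vec_eq_iff)
  with V have "b = 0" "c = 0" by blast+
  then show ?thesis by (simp add: abc a vcat2_zero vcat_zero)
qed

text \<open>\<open>V ** W\<close> is injective: if it kills \<open>s\<close>, then
  \<open>W *v s\<close> is a multiple of \<open>ones\<close>, and \<open>q\<close> annihilates the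
  image of \<open>W\<close>, so \<open>W *v s = 0\<close> and full rank gives \<open>s = 0\<close>.
  Hence \<open>Vplus V W\<close> is a right inverse of \<open>V\<close>, and
  \<open>Vplus V W ** V\<close> is the projection onto the kernel of \<open>q\<close> along
  \<open>ones\<close>.\<close>

lemma Vplus_properties:
  fixes V :: "real^'n::finite^'m::finite" and W :: "real^'m^'n"
  assumes ker: "{a. V *v a = 0} = span {ones}" and q1: "q \<bullet> ones = 1"
    and "rank W = CARD('m)" and qW: "q v* W = 0"
  shows V_Vplus: "V *v (Vplus V W *v s) = s"
    and Vplus_V: "Vplus V W *v (V *v a) = a - (q \<bullet> a) *\<^sub>R ones"
    and inner_Vplus: "q \<bullet> (Vplus V W *v s) = 0"
proof -
  \<comment> \<open>The coefficient of \<open>ones\<close> is found by pairing with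
    \<open>q\<close>, because \<open>q \<bullet> ones = 1\<close>.\<close>
  have kerD: "a = (q \<bullet> a) *\<^sub>R ones" if "V *v a = 0" for a
  proof -
    from that ker have "a \<in> span {ones}" by blast
    then obtain c where "a = c *\<^sub>R ones" by (auto simp: span_singleton)
    then show ?thesis by (simp add: q1)
  qed
  have q: "q \<bullet> (W *v s) = 0" for s
    using qW by (simp add: dot_lmul_matrix [symmetric])
  have "s = 0" if "(V ** W) *v s = 0" for s
  proof -
    from that have "V *v (W *v s) = 0" by (simp add: matrix_vector_mul_assoc)
    then have "W *v s = (q \<bullet> (W *v s)) *\<^sub>R ones" by (rule kerD)
    also have "\<dots> = W *v 0" by (simp only: q) simp
    finally show ?thesis using assms(3) by (metis full_rank_injective injD)
  qed
  then have "invertible (V ** W)" by (simp add: invertible_left_inverse matrix_left_invertible_ker)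
  then have r: "V *v (Vplus V W *v s) = s" for s
    by (simp add: Vplus_def matrix_vector_mul_assoc matrix_mul_assoc matrix_inv_right)
  show q0: "q \<bullet> (Vplus V W *v s) = 0" for s
    by (simp add: Vplus_def matrix_vector_mul_assoc [symmetric] q)
  show "V *v (Vplus V W *v s) = s" by (rule r)
  have "V *v (a - Vplus V W *v (V *v a)) = 0"
    by (simp add: matrix_vector_mult_diff_distrib r)
  then have "a - Vplus V W *v (V *v a) = (q \<bullet> (a - Vplus V W *v (V *v a))) *\<^sub>R ones"
    by (rule kerD)
  also have "\<dots> = (q \<bullet> a) *\<^sub>R ones"
    by (simp only: inner_diff_right q0 diff_zero)
  finally show "Vplus V W *v (V *v a) = a - (q \<bullet> a) *\<^sub>R ones"
    by (metis add.commute add_diff_cancel_left' diff_add_cancel)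
qed

section \<open>Mean dynamics of the closed loop\<close>

text \<open>Gaussian vectors are given by their one-dimensional projections, so integrability and
  mean are obtained for each \<open>a \<bullet> X\<close> and reassembled over the basis. A
  projection of variance zero is a point mass and forms a separate case.\<close>

lemma gaussian_vec_integrable_and_mean:
  assumes "prob_space \<Omega>" "gaussian_vec \<Omega> X \<mu> S"
  shows "integrable \<Omega> X" "prob_space.expectation \<Omega> X = \<mu>"
proof -
  have X [measurable]: "X \<in> borel_measurable \<Omega>" using assms(2) by (simp add: gaussian_vec_def)
  have psd: "0 \<le> a \<bullet> (S *v a)" for a using assms(2) by (simp add: gaussian_vec_def psd_def)
  have *: "integrable \<Omega> (\<lambda>\<omega>. a \<bullet> X \<omega>) \<and> (\<integral>\<omega>. a \<bullet> X \<omega> \<partial>\<Omega>) = a \<bullet> \<mu>" for a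
  proof (cases "a \<bullet> (S *v a) = 0")
    case True
    then have d: "distr \<Omega> borel (\<lambda>\<omega>. a \<bullet> X \<omega>) = return borel (a \<bullet> \<mu>)"
      using assms(2) by (simp add: gaussian_vec_def)
    have "integrable (return borel (a \<bullet> \<mu>)) (\<lambda>t. t)"
      by (rule integrableI_bounded) (simp_all add: nn_integral_return)
    then have "integrable \<Omega> (\<lambda>\<omega>. a \<bullet> X \<omega>)"
      unfolding d [symmetric] by (subst (asm) integrable_distr_eq) simp_all
    moreover have "(\<integral>\<omega>. a \<bullet> X \<omega> \<partial>\<Omega>) = (\<integral>t. t \<partial>distr \<Omega> borel (\<lambda>\<omega>. a \<bullet> X \<omega>))"
      by (subst integral_distr) simp_all
    ultimately show ?thesis by (simp add: d integral_return)
  next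
    case False
    define \<sigma> where "\<sigma> = sqrt (a \<bullet> (S *v a))"
    have "\<sigma> > 0" using False psd [of a] by (simp add: \<sigma>_def)
    have "distr \<Omega> borel (\<lambda>\<omega>. a \<bullet> X \<omega>) = density lborel (normal_density (a \<bullet> \<mu>) \<sigma>)"
      using assms(2) False by (simp add: gaussian_vec_def \<sigma>_def)
    then have D: "distributed \<Omega> lborel (\<lambda>\<omega>. a \<bullet> X \<omega>) (normal_density (a \<bullet> \<mu>) \<sigma>)"
      by (simp add: distributed_def cong: distr_cong)
    have "integrable \<Omega> (\<lambda>\<omega>. a \<bullet> X \<omega>)"
      using distributed_integrable [OF D, of "\<lambda>t. t"] integrable_normal_moment_nz_1 [OF \<open>\<sigma> > 0\<close>, of "a \<bullet> \<mu>"]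
      by simp
    then show ?thesis
      using prob_space.normal_distributed_expectation [OF assms(1) \<open>\<sigma> > 0\<close> D] by simp
  qed
  have "integrable \<Omega> (\<lambda>\<omega>. \<Sum>b\<in>Basis. (X \<omega> \<bullet> b) *\<^sub>R b)"
    using * by (intro Bochner_Integration.integrable_sum integrable_scaleR_left)
      (simp add: inner_commute)
  then show int: "integrable \<Omega> X" by (simp add: euclidean_representation)
  have "a \<bullet> (\<integral>\<omega>. X \<omega> \<partial>\<Omega>) = a \<bullet> \<mu>" for a
    using * [of a] int by simp
  then show "prob_space.expectation \<Omega> X = \<mu>"
    by (metis vector_eq_ldot)
qed

lemma contraction_forced_tendsto_zero:
  fixes m h :: "nat \<Rightarrow> 'a::real_normed_vector"
  assumes a: "\<bar>a\<bar> < 1" and step: "\<And>k. m (Suc k) = a *\<^sub>R m k + h k" and h: "h \<longlonglongrightarrow> 0"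
  shows "m \<longlonglongrightarrow> 0"
proof (rule LIMSEQ_I)
  fix e :: real assume "e > 0"
  \<comment> \<open>Chosen so that \<open>e / 2\<close> is the fixed point of
    \<open>t \<mapsto> \<bar>a\<bar> * t + d\<close>; the bound below then reproduces
    itself.\<close>
  define d where "d = e / 2 * (1 - \<bar>a\<bar>)"
  have "d > 0" using a \<open>e > 0\<close> by (simp add: d_def)
  then obtain N where N: "\<And>k. k \<ge> N \<Longrightarrow> norm (h k) < d" using LIMSEQ_D [OF h] by auto
  have bound: "norm (m (j + N)) \<le> \<bar>a\<bar> ^ j * norm (m N) + e / 2" for j
  proof (induction j)
    case 0
    then show ?case using \<open>e > 0\<close> by simp
  next
    case (Suc j)
    have "norm (m (Suc j + N)) \<le> \<bar>a\<bar> * norm (m (j + N)) + norm (h (j + N))"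
      using norm_triangle_ineq [of "a *\<^sub>R m (j + N)" "h (j + N)"] by (simp add: step)
    also have "\<dots> \<le> \<bar>a\<bar> * (\<bar>a\<bar> ^ j * norm (m N) + e / 2) + d"
      using Suc N [of "j + N"] by (intro add_mono mult_left_mono) auto
    also have "\<dots> = \<bar>a\<bar> ^ Suc j * norm (m N) + e / 2"
      by (simp add: d_def field_simps)
    finally show ?case .
  qed
  have "(\<lambda>j. \<bar>a\<bar> ^ j * norm (m N)) \<longlonglongrightarrow> 0"
    using a by (intro tendsto_mult_left_zero LIMSEQ_power_zero) simp
  from LIMSEQ_D [OF this, of "e / 2"] \<open>e > 0\<close>
  obtain M where M: "\<And>j. j \<ge> M \<Longrightarrow> \<bar>a\<bar> ^ j * norm (m N) < e / 2" by auto
  have "norm (m k - 0) < e" if "k \<ge> M + N" for k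
    using bound [of "k - N"] M [of "k - N"] that by fastforce
  then show "\<exists>K. \<forall>k\<ge>K. norm (m k - 0) < e" by blast
qed

section \<open>Recursions of the closed loop along a sample path\<close>

abbreviation feedback_matrix ::
    "real \<Rightarrow> real^('c::finite + 'h::finite)^'m::finite \<Rightarrow> real \<Rightarrow> real^(2 \<times> 'm + 'h)^'m" where
  "feedback_matrix \<tau> V \<gamma> \<equiv> hcat (row_left (Fmat \<tau> \<gamma> \<otimes>\<^sub>K mat 1)) ((\<tau> / 2) *\<^sub>R (V ** Jmat))"

lemma feedback_matrix_mult:
  "feedback_matrix \<tau> V \<gamma> *v vcat (vcat2 a b) c =
     (\<gamma> / \<tau>) *\<^sub>R a + b + (\<tau> / 2) *\<^sub>R (V *v (Jmat *v c))"
  by (simp add: row_left_kron_mult scaled_mult_vec matrix_vector_mul_assoc)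

lemma plant_step:
  assumes "plant \<tau> V v w x z u y" "x k = vcat2 p f" "upper (v k) = vcat2 v1 v2"
  shows plant_step_x: "x (Suc k) =
      vcat2 (p + \<tau> *\<^sub>R f + (\<tau>\<^sup>2 / 2) *\<^sub>R (Jmat *v z k) + \<tau> *\<^sub>R u k + v1)
        (f + \<tau> *\<^sub>R (Jmat *v z k) + u k + v2)"
    and plant_step_z: "z (Suc k) = z k + lower (v k)"
proof -
  have v: "v k = vcat (vcat2 v1 v2) (lower (v k))" using assms(3) by (simp add: vcat_eq_iff)
  have "vcat (x (Suc k)) (z (Suc k)) =
       block (Amat \<tau> \<otimes>\<^sub>K mat 1) (col_left (\<beta>mat \<tau> \<otimes>\<^sub>K Jmat)) 0 (mat 1) *v vcat (x k) (z k)
       + vcat (col_left (Bmat \<tau> \<otimes>\<^sub>K mat 1)) 0 *v u k + vcat (vcat2 v1 v2) (lower (v k))"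
    using assms(1) unfolding plant_def v [symmetric] by blast
  also have "\<dots> =
      vcat (vcat2 (p + \<tau> *\<^sub>R f + (\<tau>\<^sup>2 / 2) *\<^sub>R (Jmat *v z k) + \<tau> *\<^sub>R u k + v1)
        (f + \<tau> *\<^sub>R (Jmat *v z k) + u k + v2)) (z k + lower (v k))"
    by (simp add: assms(2) kron_mult_vcat2 col_left_kron_mult vcat_add vcat2_add)
  finally show "x (Suc k) =
      vcat2 (p + \<tau> *\<^sub>R f + (\<tau>\<^sup>2 / 2) *\<^sub>R (Jmat *v z k) + \<tau> *\<^sub>R u k + v1)
        (f + \<tau> *\<^sub>R (Jmat *v z k) + u k + v2)" "z (Suc k) = z k + lower (v k)"
    by (simp_all add: vcat_eq_iff)
qed

text \<open>\<open>V\<close> acts inside the blocks while the system coefficients mix them, so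
  \<open>To V\<close> intertwines the plant matrices with \<open>Aoo \<tau> V\<close> and
  \<open>Bo \<tau> V\<close>.\<close>

lemma plant_\<eta>_o:
  assumes "plant \<tau> V v w x z u y"
  shows "\<eta>_o V (x (Suc k)) (z (Suc k)) =
           Aoo \<tau> V *v \<eta>_o V (x k) (z k) + Bo \<tau> V *v u k + To V *v v k"
    and "y k = Co *v \<eta>_o V (x k) (z k) + w k"
proof -
  obtain p f where x: "x k = vcat2 p f" by (metis vcat2_cases)
  obtain v1 v2 where v: "upper (v k) = vcat2 v1 v2" by (metis vcat2_cases)
  have v': "v k = vcat (vcat2 v1 v2) (lower (v k))" using v by (simp add: vcat_eq_iff)
  show "\<eta>_o V (x (Suc k)) (z (Suc k)) =
           Aoo \<tau> V *v \<eta>_o V (x k) (z k) + Bo \<tau> V *v u k + To V *v v k"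
    by (subst v') (simp add: plant_step_x [OF assms x v] plant_step_z [OF assms x v] x vcat_add vcat2_add
        matrix_vector_right_distrib matrix_vector_mult_scaleR)
  show "y k = Co *v \<eta>_o V (x k) (z k) + w k"
    using assms unfolding plant_def by (simp add: x row_left_kron_mult)
qed

text \<open>Plant and filter receive the same input, which cancels in the estimation error; the
  error is therefore free of the feedback gain.\<close>

lemma closed_loop_error_step:
  assumes "closed_loop \<tau> V W r P \<gamma> v w x z u y em e"
  defines "L \<equiv> innovation_gain r P"
  shows "\<eta>_o V (x (Suc k)) (z (Suc k)) - e (Suc k) =
           (mat 1 - L ** Co) *v (Aoo \<tau> V *v (\<eta>_o V (x k) (z k) - e k))
           + ((mat 1 - L ** Co) *v (To V *v v k) - L *v w (Suc k))"
proof -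
  have pl: "plant \<tau> V v w x z u y" and kf: "kalman_filter \<tau> V r P u y em e"
    using assms(1) by (auto simp: closed_loop_def)
  have em: "em (Suc k) = Aoo \<tau> V *v e k + Bo \<tau> V *v u k"
    and e: "e (Suc k) = em (Suc k) + L *v (y (Suc k) - Co *v em (Suc k))"
    using kf by (auto simp: kalman_filter_def L_def)
  \<comment> \<open>The prior error. The correction uses the output at \<open>Suc k\<close>, hence
    \<open>w (Suc k)\<close> next to \<open>v k\<close>.\<close>
  define n where "n = \<eta>_o V (x (Suc k)) (z (Suc k)) - em (Suc k)"
  have 1: "n = Aoo \<tau> V *v (\<eta>_o V (x k) (z k) - e k) + To V *v v k"
    by (simp add: n_def em plant_\<eta>_o(1) [OF pl] matrix_vector_mult_diff_distrib del: Bo_mult)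
  have 2: "\<eta>_o V (x (Suc k)) (z (Suc k)) - e (Suc k) = n - L *v (Co *v n + w (Suc k))"
    unfolding e plant_\<eta>_o(2) [OF pl]
    by (simp add: n_def matrix_vector_mult_diff_distrib algebra_simps)
  have 3: "(mat 1 - L ** Co) *v s = s - L *v (Co *v s)" for s
    by (simp add: matrix_vector_mult_diff_rdistrib matrix_vector_mul_assoc [symmetric])
  show ?thesis
    unfolding 2 1 3 by (simp add: matrix_vector_right_distrib)
qed

text \<open>The gains are tuned so that \<open>\<tau>\<close> times the feedback of the true state
  is \<open>\<gamma>\<close> times the phase plus exactly the increment due to frequency and drift.
  This increment cancels, leaving the factor \<open>1 - \<gamma>\<close> and the feedback of the
  estimation error.\<close>

lemma closed_loop_phase_step:
  assumes "closed_loop \<tau> V W r P \<gamma> v w x z u y em e" "\<tau> > 0"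
    and VW: "\<And>s. V *v (Vplus V W *v s) = s"
  shows "V *v time_dev (x (Suc k)) =
           (1 - \<gamma>) *\<^sub>R (V *v time_dev (x k))
           + \<tau> *\<^sub>R (feedback_matrix \<tau> V \<gamma> *v (\<eta>_o V (x k) (z k) - e k)) + Co *v (To V *v v k)"
proof -
  have pl: "plant \<tau> V v w x z u y" and fb: "feedback \<tau> V W \<gamma> e u"
    using assms(1) by (auto simp: closed_loop_def)
  obtain p f where x: "x k = vcat2 p f" by (metis vcat2_cases)
  obtain v1 v2 where v: "upper (v k) = vcat2 v1 v2" by (metis vcat2_cases)
  have v': "v k = vcat (vcat2 v1 v2) (lower (v k))" using v by (simp add: vcat_eq_iff)
  have CT: "Co *v (To V *v v k) = V *v v1" by (subst v') simp
  have u: "V *v u k = - (feedback_matrix \<tau> V \<gamma> *v e k)"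
    using fb by (simp add: feedback_def VW)
  have "\<tau> *\<^sub>R (feedback_matrix \<tau> V \<gamma> *v \<eta>_o V (x k) (z k)) =
      \<gamma> *\<^sub>R (V *v p) + \<tau> *\<^sub>R (V *v f) + (\<tau>\<^sup>2 / 2) *\<^sub>R (V *v (Jmat *v z k))"
    using \<open>\<tau> > 0\<close>
    by (simp add: x feedback_matrix_mult scaleR_add_right power2_eq_square del: hcat_mult_vcat)
  then show ?thesis
    by (simp add: plant_step_x [OF pl x v] x CT u matrix_vector_right_distrib matrix_vector_mult_scaleR
        matrix_vector_mult_diff_distrib algebra_simps)
qed

section \<open>Expectations along the closed loop\<close>

lemma integrable_matrix_vector_mult:
  fixes M :: "real^'n::finite^'m::finite"
  assumes "integrable \<Omega> X" shows "integrable \<Omega> (\<lambda>\<omega>. M *v X \<omega>)"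
  using integrable_bounded_linear [OF matrix_vector_mul_bounded_linear assms] .

lemma integral_matrix_vector_mult:
  fixes M :: "real^'n::finite^'m::finite"
  assumes "integrable \<Omega> X" shows "(\<integral>\<omega>. M *v X \<omega> \<partial>\<Omega>) = M *v (\<integral>\<omega>. X \<omega> \<partial>\<Omega>)"
  using integral_bounded_linear [OF matrix_vector_mul_bounded_linear assms] .

text \<open>Integrability propagates by induction from the initial data and the noise; the
  expectation of the two pathwise recursions then loses the zero-mean noise terms.\<close>

lemma closed_loop_means:
  assumes "prob_space \<Omega>" "white_gaussian \<Omega> v S1" "white_gaussian \<Omega> w S2" "\<tau> > 0"
    and VW: "\<And>s. V *v (Vplus V W *v s) = s"
    and clp: "closed_loop_process \<Omega> \<tau> V W r P \<gamma> v w x z u y em e"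
  defines "\<mu> \<equiv> \<lambda>k. prob_space.expectation \<Omega> (\<lambda>\<omega>. \<eta>_o V (x k \<omega>) (z k \<omega>) - e k \<omega>)"
    and "m \<equiv> \<lambda>k. prob_space.expectation \<Omega> (\<lambda>\<omega>. V *v time_dev (x k \<omega>))"
  shows "integrable \<Omega> (\<lambda>\<omega>. V *v time_dev (x k \<omega>))"
    and "\<mu> (Suc k) = (mat 1 - innovation_gain r P ** Co) *v (Aoo \<tau> V *v \<mu> k)"
    and "m (Suc k) = (1 - \<gamma>) *\<^sub>R m k + \<tau> *\<^sub>R (feedback_matrix \<tau> V \<gamma> *v \<mu> k)"
proof -
  have "gaussian_vec \<Omega> (v k) 0 S1" "gaussian_vec \<Omega> (w k) 0 S2" for k
    using assms(2,3) by (auto simp: white_gaussian_def)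
  note gauss = this [THEN gaussian_vec_integrable_and_mean(1) [OF \<open>prob_space \<Omega>\<close>]]
    this [THEN gaussian_vec_integrable_and_mean(2) [OF \<open>prob_space \<Omega>\<close>]]
  have v: "integrable \<Omega> (v k)" "(\<integral>\<omega>. v k \<omega> \<partial>\<Omega>) = 0"
    and w: "integrable \<Omega> (w k)" "(\<integral>\<omega>. w k \<omega> \<partial>\<Omega>) = 0" for k
    by (simp_all add: gauss)
  have cl: "closed_loop \<tau> V W r P \<gamma> (\<lambda>k. v k \<omega>) (\<lambda>k. w k \<omega>) (\<lambda>k. x k \<omega>) (\<lambda>k. z k \<omega>)
      (\<lambda>k. u k \<omega>) (\<lambda>k. y k \<omega>) (\<lambda>k. em k \<omega>) (\<lambda>k. e k \<omega>)" if "\<omega> \<in> space \<Omega>" for \<omega>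
    using clp that by (auto simp: closed_loop_process_def)
  have init: "integrable \<Omega> (x 0)" "integrable \<Omega> (z 0)" "integrable \<Omega> (e 0)"
    using clp by (auto simp: closed_loop_process_def)
  let ?L = "innovation_gain r P" let ?G = "mat 1 - ?L ** Co"
  define \<epsilon> where "\<epsilon> k \<omega> = \<eta>_o V (x k \<omega>) (z k \<omega>) - e k \<omega>" for k \<omega>
  define \<xi> where "\<xi> k \<omega> = V *v time_dev (x k \<omega>)" for k \<omega>
  note ints = integrable_matrix_vector_mult Bochner_Integration.integrable_add
    Bochner_Integration.integrable_diff integrable_scaleR_right v(1) w(1)
  have \<epsilon>_step: "\<epsilon> (Suc k) \<omega> = ?G *v (Aoo \<tau> V *v \<epsilon> k \<omega>) + (?G *v (To V *v v k \<omega>) - ?L *v w (Suc k) \<omega>)"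
    if "\<omega> \<in> space \<Omega>" for k \<omega>
    using closed_loop_error_step [OF cl [OF that]] by (simp only: \<epsilon>_def)
  have \<xi>_step: "\<xi> (Suc k) \<omega> = (1 - \<gamma>) *\<^sub>R \<xi> k \<omega>
           + \<tau> *\<^sub>R (feedback_matrix \<tau> V \<gamma> *v \<epsilon> k \<omega>) + Co *v (To V *v v k \<omega>)"
    if "\<omega> \<in> space \<Omega>" for k \<omega>
    using closed_loop_phase_step [OF cl [OF that] \<open>\<tau> > 0\<close> VW] by (simp only: \<epsilon>_def \<xi>_def)
  \<comment> \<open>Exhibits the observable state as a linear image of \<open>x\<close> and
    \<open>z\<close>, so that it inherits their integrability.\<close>
  have split: "\<eta>_o V x z = To V *v (vcat (mat 1) 0 *v x + vcat 0 (mat 1) *v z)" for x z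
    by (simp add: \<eta>_o_def vcat_add)
  have \<eta>0: "integrable \<Omega> (\<lambda>\<omega>. \<eta>_o V (x 0 \<omega>) (z 0 \<omega>))"
    unfolding split by (intro ints init)
  have \<epsilon>_int: "integrable \<Omega> (\<epsilon> k)" for k
  proof (induction k)
    case 0
    then show ?case unfolding \<epsilon>_def by (intro ints \<eta>0 init)
  next
    case (Suc k)
    then have "integrable \<Omega> (\<lambda>\<omega>. ?G *v (Aoo \<tau> V *v \<epsilon> k \<omega>) + (?G *v (To V *v v k \<omega>) - ?L *v w (Suc k) \<omega>))"
      by (intro ints)
    \<comment> \<open>The recursion is known on the sample space only, so it is transferred by
      congruence of integrability.\<close>
    then show ?case
      by (rule Bochner_Integration.integrable_cong [OF refl, THEN iffD2, rotated]) (rule \<epsilon>_step)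
  qed
  have \<xi>_int: "integrable \<Omega> (\<xi> k)" for k
  proof (induction k)
    case 0
    have "integrable \<Omega> (\<lambda>\<omega>. Co *v \<eta>_o V (x 0 \<omega>) (z 0 \<omega>))" by (intro ints \<eta>0)
    then show ?case by (simp add: Co_\<eta>_o \<xi>_def)
  next
    case (Suc k)
    then have "integrable \<Omega> (\<lambda>\<omega>. (1 - \<gamma>) *\<^sub>R \<xi> k \<omega>
           + \<tau> *\<^sub>R (feedback_matrix \<tau> V \<gamma> *v \<epsilon> k \<omega>) + Co *v (To V *v v k \<omega>))"
      using \<epsilon>_int by (intro ints)
    then show ?case
      by (rule Bochner_Integration.integrable_cong [OF refl, THEN iffD2, rotated]) (rule \<xi>_step)
  qed
  then show "integrable \<Omega> (\<lambda>\<omega>. V *v time_dev (x k \<omega>))" by (simp add: \<xi>_def [abs_def])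
  have m: "m k = (\<integral>\<omega>. \<xi> k \<omega> \<partial>\<Omega>)" for k by (simp only: m_def \<xi>_def)
  have \<mu>: "\<mu> k = (\<integral>\<omega>. \<epsilon> k \<omega> \<partial>\<Omega>)" for k by (simp only: \<mu>_def \<epsilon>_def)
  have "\<mu> (Suc k) = (\<integral>\<omega>. ?G *v (Aoo \<tau> V *v \<epsilon> k \<omega>) + (?G *v (To V *v v k \<omega>) - ?L *v w (Suc k) \<omega>) \<partial>\<Omega>)"
    unfolding \<mu> by (rule Bochner_Integration.integral_cong [OF refl \<epsilon>_step])
  also have "\<dots> = ?G *v (Aoo \<tau> V *v \<mu> k)"
    by (simp add: ints \<epsilon>_int integral_matrix_vector_mult v w \<mu>)
  finally show "\<mu> (Suc k) = ?G *v (Aoo \<tau> V *v \<mu> k)" .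
  have "m (Suc k) = (\<integral>\<omega>. (1 - \<gamma>) *\<^sub>R \<xi> k \<omega>
           + \<tau> *\<^sub>R (feedback_matrix \<tau> V \<gamma> *v \<epsilon> k \<omega>) + Co *v (To V *v v k \<omega>) \<partial>\<Omega>)"
    unfolding m by (rule Bochner_Integration.integral_cong [OF refl \<xi>_step])
  also have "\<dots> = (1 - \<gamma>) *\<^sub>R m k + \<tau> *\<^sub>R (feedback_matrix \<tau> V \<gamma> *v \<mu> k)"
    by (simp add: ints \<xi>_int \<epsilon>_int integral_matrix_vector_mult v m \<mu>)
  finally show "m (Suc k) = (1 - \<gamma>) *\<^sub>R m k + \<tau> *\<^sub>R (feedback_matrix \<tau> V \<gamma> *v \<mu> k)" .
qed

text \<open>Guards the universally quantified limit statement against holding vacuously, and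
  supplies the process for necessity. The loop is causal: plant state and posterior estimate
  determine the input, then the next state and output, then the next estimate.\<close>

lemma closed_loop_process_exists:
  fixes \<Omega> :: "'w measure" and V :: "real^('c::finite + 'h::finite)^'m::finite"
  assumes "prob_space \<Omega>"
  obtains x z u y em e where "closed_loop_process \<Omega> \<tau> V W r P \<gamma> v w x z u y em e"
    "x 0 = (\<lambda>_. x0)" "z 0 = (\<lambda>_. z0)" "e 0 = (\<lambda>_. e0)"
proof -
  define fb where "fb e = Vplus V W *v (- (feedback_matrix \<tau> V \<gamma> *v e))" for e
  define xz where "xz k \<omega> s = block (Amat \<tau> \<otimes>\<^sub>K mat 1) (col_left (\<beta>mat \<tau> \<otimes>\<^sub>K Jmat)) 0 (mat 1) *v vcat (fst s) (fst (snd s))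
       + vcat (col_left (Bmat \<tau> \<otimes>\<^sub>K mat 1)) 0 *v fb (snd (snd s)) + v k \<omega>"
    for k \<omega> and s :: "(real^(2 \<times> ('c + 'h))) \<times> (real^'h) \<times> (real^(2 \<times> 'm + 'h))"
  define out where "out k \<omega> s = hcat (row_left (Cmat \<otimes>\<^sub>K V)) 0 *v s + w k \<omega>"
    for k \<omega> and s :: "real^(2 \<times> ('c + 'h) + 'h)"
  define pri where "pri s = Aoo \<tau> V *v snd (snd s) + Bo \<tau> V *v fb (snd (snd s))"
    for s :: "(real^(2 \<times> ('c + 'h))) \<times> (real^'h) \<times> (real^(2 \<times> 'm + 'h))"
  define s where "s k \<omega> = rec_nat (x0, z0, e0) (\<lambda>k s. (upper (xz k \<omega> s), lower (xz k \<omega> s),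
      pri s + innovation_gain r P *v (out (Suc k) \<omega> (xz k \<omega> s) - Co *v pri s))) k" for k \<omega>
  have s0: "s 0 \<omega> = (x0, z0, e0)" for \<omega> by (simp add: s_def)
  have sS: "s (Suc k) \<omega> = (upper (xz k \<omega> (s k \<omega>)), lower (xz k \<omega> (s k \<omega>)),
      pri (s k \<omega>) + innovation_gain r P *v (out (Suc k) \<omega> (xz k \<omega> (s k \<omega>)) - Co *v pri (s k \<omega>)))" for k \<omega>
    by (simp add: s_def)
  let ?x = "\<lambda>k \<omega>. fst (s k \<omega>)" let ?z = "\<lambda>k \<omega>. fst (snd (s k \<omega>))" let ?e = "\<lambda>k \<omega>. snd (snd (s k \<omega>))"
  \<comment> \<open>At \<open>k = 0\<close> the index \<open>k - 1\<close> is again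
    \<open>0\<close>; this value of the prior estimate is arbitrary, as the filter constrains it at
    successors only.\<close>
  have "closed_loop_process \<Omega> \<tau> V W r P \<gamma> v w ?x ?z (\<lambda>k \<omega>. fb (?e k \<omega>))
      (\<lambda>k \<omega>. out k \<omega> (vcat (?x k \<omega>) (?z k \<omega>))) (\<lambda>k \<omega>. pri (s (k - 1) \<omega>)) ?e"
    using prob_space.finite_measure [OF assms]
    unfolding closed_loop_process_def closed_loop_def plant_def kalman_filter_def feedback_def
    by (simp only: s0 sS fst_conv snd_conv vcat_upper_lower diff_Suc_1)
       (simp add: finite_measure.integrable_const xz_def [abs_def] out_def pri_def fb_def)
  then show ?thesis by (rule that) (simp_all add: s0)
qed

text \<open>The input lies in the image of \<open>Vplus V W\<close>, which \<open>q\<close>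
  annihilates, so the weighted mean of the clocks runs freely.\<close>

lemma unobservable_step:
  assumes "closed_loop \<tau> V W r P \<gamma> v w x z u y em e"
    and qV: "\<And>s. q \<bullet> (Vplus V W *v s) = 0"
  shows "\<eta>_unobs q (x (Suc k)) = Amat \<tau> *v \<eta>_unobs q (x k)
           + col_left (row_right (\<beta>mat \<tau> \<otimes>\<^sub>K (rowvector q ** Jmat))) *v lower (\<eta>_o V (x k) (z k))
           + row_right (mat 1 \<otimes>\<^sub>K rowvector q) *v upper (v k)"
proof -
  have pl: "plant \<tau> V v w x z u y" and fb: "feedback \<tau> V W \<gamma> e u"
    using assms(1) by (auto simp: closed_loop_def)
  obtain p f where x: "x k = vcat2 p f" by (metis vcat2_cases)
  obtain v1 v2 where v: "upper (v k) = vcat2 v1 v2" by (metis vcat2_cases)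
  have "q \<bullet> u k = 0" using fb unfolding feedback_def by (simp only: qV)
  then show ?thesis
    unfolding plant_step_x [OF pl x v] x v \<eta>_unobs_vcat2 col_left_row_right_kron_mult row_right_kron_mult
    by (simp add: vec_eq_iff forall_2 matrix_vector_mult_def [of "Amat _"] sum_2 inner_add_right)
qed

section \<open>The synchronization criterion\<close>

theorem theorem2:
  fixes \<Omega> :: "'w measure"
    and \<tau> r \<gamma> :: real
    and \<sigma>1 \<sigma>2 :: "real^('c::finite + 'h::finite)"
    and \<sigma>3 :: "real^'h"
    and V :: "real^('c + 'h)^'m::finite"
    and W :: "real^'m^('c + 'h)"
    and q :: "real^('c + 'h)"
    and v :: "nat \<Rightarrow> 'w \<Rightarrow> real^(2 \<times> ('c + 'h) + 'h)"
    and w :: "nat \<Rightarrow> 'w \<Rightarrow> real^'m"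
    and P :: "real^(2 \<times> 'm + 'h)^(2 \<times> 'm + 'h)"
  assumes "prob_space \<Omega>"
    and "CARD('m) = CARD('c + 'h) - 1"
    and "\<tau> > 0" and "r > 0"
    and "\<forall>i. \<sigma>1 $ i \<ge> 0" and "\<forall>i. \<sigma>2 $ i \<ge> 0"
    and "\<forall>i. \<sigma>2 $ Inl i > 0" and "\<forall>j. \<sigma>3 $ j > 0"
    and "{a. V *v a = 0} = span {ones}"
    and "q \<bullet> ones = 1"
    and "rank W = CARD('m)" and "q v* W = 0"
    and "white_gaussian \<Omega> v (noise_cov \<tau> \<sigma>1 \<sigma>2 \<sigma>3)"
    and "white_gaussian \<Omega> w (r *\<^sub>R mat 1)"
    and "steady_prior_cov \<tau> V r (noise_cov \<tau> \<sigma>1 \<sigma>2 \<sigma>3) P"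
  shows "((\<forall>x z u y em e. closed_loop_process \<Omega> \<tau> V W r P \<gamma> v w x z u y em e \<longrightarrow>
             (\<lambda>k. prob_space.expectation \<Omega>
                    (\<lambda>\<omega>. time_dev (x k \<omega>) - \<theta>_unobs q (x k \<omega>) *\<^sub>R ones)) \<longlonglongrightarrow> 0)
          \<longleftrightarrow> \<bar>1 - \<gamma>\<bar> < 1)
       \<and> (\<forall>x z u y em e. closed_loop_process \<Omega> \<tau> V W r P \<gamma> v w x z u y em e \<longrightarrow>
            (\<forall>k. \<forall>\<omega>\<in>space \<Omega>.
               \<eta>_unobs q (x (Suc k) \<omega>) =
                 Amat \<tau> *v \<eta>_unobs q (x k \<omega>)
                 + col_left (row_right (\<beta>mat \<tau> \<otimes>\<^sub>K (rowvector q ** Jmat)))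
                     *v lower (\<eta>_o V (x k \<omega>) (z k \<omega>))
                 + row_right (mat 1 \<otimes>\<^sub>K rowvector q) *v upper (v k \<omega>)))"
proof (intro conjI allI impI ballI)
  note VW = V_Vplus [OF assms(9-12)] and WV = Vplus_V [OF assms(9-12)]
    and qW = inner_Vplus [OF assms(9-12)]
  let ?Q = "To V ** noise_cov \<tau> \<sigma>1 \<sigma>2 \<sigma>3 ** transpose (To V)"
  let ?L = "innovation_gain r P :: real^'m^(2 \<times> 'm + 'h)"
  \<comment> \<open>A right inverse of \<open>V\<close> makes its transpose injective.\<close>
  have injV: "a = 0" if "a v* V = 0" for a :: "real^'m"
  proof -
    have "a \<bullet> a = (a v* V) \<bullet> (Vplus V W *v a)" by (simp add: dot_lmul_matrix VW)
    with that show ?thesis by simp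
  qed
  have psdQ: "psd ?Q"
    using assms(13) by (auto simp: white_gaussian_def gaussian_vec_def intro: psd_congruence)
  have psdP: "psd P" and ric: "P = ?Q + Aoo \<tau> V ** P ** transpose (Aoo \<tau> V)
       - Aoo \<tau> V ** P ** transpose Co ** matrix_inv (Co ** P ** transpose Co + r *\<^sub>R mat 1)
         ** Co ** P ** transpose (Aoo \<tau> V)"
    using assms(15) unfolding steady_prior_cov_def by blast+
  \<comment> \<open>The posterior error has the factors \<open>mat 1 - ?L ** Co\<close> and
    \<open>Aoo \<tau> V\<close> in the opposite order to the Riccati lemma. The lemma is therefore
    applied to the prior mean \<open>Aoo \<tau> V *v \<mu> k\<close>, from which the next
    \<open>\<mu>\<close> is recovered.\<close>
  have error_decay: "\<mu> \<longlonglongrightarrow> 0"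
    if step: "\<And>k. \<mu> (Suc k) = (mat 1 - ?L ** Co) *v (Aoo \<tau> V *v \<mu> k)" for \<mu>
  proof -
    have "(\<lambda>k. Aoo \<tau> V *v \<mu> k) \<longlonglongrightarrow> 0"
    proof (rule riccati_error_dynamics_tendsto_zero [OF \<open>r > 0\<close> psdP psdQ ric Aoo_unipotent])
      show "y = 0" if "y v* (Aoo \<tau> V - mat 1) = 0" "?Q *v y = 0" for y
        using noise_excites_observable_modes [OF \<open>\<tau> > 0\<close> _ _ injV that] assms(7,8) by blast
      show "Aoo \<tau> V *v \<mu> (Suc k) = (Aoo \<tau> V ** (mat 1 - P ** transpose Co **
          matrix_inv (Co ** P ** transpose Co + r *\<^sub>R mat 1) ** Co)) *v (Aoo \<tau> V *v \<mu> k)" for k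
        unfolding step innovation_gain_def by (simp only: matrix_vector_mul_assoc matrix_mul_assoc)
    qed
    then have "(\<lambda>k. \<mu> (Suc k)) \<longlonglongrightarrow> 0" unfolding step by (rule matrix_vector_mult_tendsto_zero)
    then show ?thesis by (rule LIMSEQ_imp_Suc)
  qed
  have mean_dev: "prob_space.expectation \<Omega> (\<lambda>\<omega>. time_dev (x k \<omega>) - \<theta>_unobs q (x k \<omega>) *\<^sub>R ones)
      = Vplus V W *v prob_space.expectation \<Omega> (\<lambda>\<omega>. V *v time_dev (x k \<omega>))"
    if "closed_loop_process \<Omega> \<tau> V W r P \<gamma> v w x z u y em e" for x z u y em e k
    unfolding \<theta>_unobs_eq WV [symmetric]
    by (rule integral_matrix_vector_mult)
       (rule closed_loop_means(1) [OF assms(1,13,14,3) VW that])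
  show "(\<forall>x z u y em e. closed_loop_process \<Omega> \<tau> V W r P \<gamma> v w x z u y em e \<longrightarrow>
             (\<lambda>k. prob_space.expectation \<Omega>
                    (\<lambda>\<omega>. time_dev (x k \<omega>) - \<theta>_unobs q (x k \<omega>) *\<^sub>R ones)) \<longlonglongrightarrow> 0)
          \<longleftrightarrow> \<bar>1 - \<gamma>\<bar> < 1" (is "?lim \<longleftrightarrow> _")
  proof
    assume ?lim
    \<comment> \<open>Makes the initial value of \<open>V p\<close> equal to \<open>ones\<close>,
      while the exact initial estimate keeps the mean error at zero; the mean phase is then a pure
      geometric sequence.\<close>
    define x0 :: "real^(2 \<times> ('c + 'h))" where "x0 = vcat2 (Vplus V W *v ones) 0"
    obtain x z u y em e where clp: "closed_loop_process \<Omega> \<tau> V W r P \<gamma> v w x z u y em e"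
      and init: "x 0 = (\<lambda>_. x0)" "z 0 = (\<lambda>_. 0)" "e 0 = (\<lambda>_. \<eta>_o V x0 0)"
      by (rule closed_loop_process_exists [OF assms(1)])
    note means = closed_loop_means(2,3) [OF assms(1,13,14,3) VW clp]
    define \<mu> where "\<mu> k = prob_space.expectation \<Omega> (\<lambda>\<omega>. \<eta>_o V (x k \<omega>) (z k \<omega>) - e k \<omega>)" for k
    define m where "m k = prob_space.expectation \<Omega> (\<lambda>\<omega>. V *v time_dev (x k \<omega>))" for k
    have \<mu>: "\<mu> k = 0" for k
    proof (induction k)
      case 0
      then show ?case by (simp add: \<mu>_def init)
    next
      case (Suc k)
      then show ?case using means(1) [of k, folded \<mu>_def] by simp
    qed
    have m: "m k = (1 - \<gamma>) ^ k *\<^sub>R ones" for k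
    proof (induction k)
      case 0
      then show ?case
        using prob_space.prob_space [OF assms(1)] by (simp add: m_def init x0_def VW)
    next
      case (Suc k)
      then show ?case using means(2) [of k, folded m_def \<mu>_def] by (simp add: \<mu>)
    qed
    have "(\<lambda>k. Vplus V W *v m k) \<longlonglongrightarrow> 0"
      using \<open>?lim\<close> clp unfolding m_def mean_dev [OF clp, symmetric] by blast
    then have "(\<lambda>k. V *v (Vplus V W *v m k)) \<longlonglongrightarrow> 0" by (rule matrix_vector_mult_tendsto_zero)
    then have "(\<lambda>k. (1 - \<gamma>) ^ k *\<^sub>R (ones :: real^'m)) \<longlonglongrightarrow> 0" by (simp only: VW m)
    \<comment> \<open>\<open>undefined\<close> is just some index of type \<open>'m\<close>; all
      entries of \<open>ones\<close> agree.\<close>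
    from tendsto_vec_nth [OF this, of undefined]
    have "(\<lambda>k. (1 - \<gamma>) ^ k) \<longlonglongrightarrow> 0" by (simp add: ones_def)
    \<comment> \<open>A single power below one is enough, since a base of at least one has no such
      power.\<close>
    from LIMSEQ_D [OF this, of 1] obtain k where "\<bar>1 - \<gamma>\<bar> ^ k < 1"
      by (auto simp: power_abs)
    then show "\<bar>1 - \<gamma>\<bar> < 1" by (meson not_le one_le_power)
  next
    assume "\<bar>1 - \<gamma>\<bar> < 1"
    show ?lim
    proof (intro allI impI)
      fix x z u y em e assume clp: "closed_loop_process \<Omega> \<tau> V W r P \<gamma> v w x z u y em e"
      note means = closed_loop_means(2,3) [OF assms(1,13,14,3) VW clp]
      have "(\<lambda>k. prob_space.expectation \<Omega> (\<lambda>\<omega>. V *v time_dev (x k \<omega>))) \<longlonglongrightarrow> 0"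
      proof (rule contraction_forced_tendsto_zero [OF \<open>\<bar>1 - \<gamma>\<bar> < 1\<close>], rule means(2))
        have "(\<lambda>k. prob_space.expectation \<Omega> (\<lambda>\<omega>. \<eta>_o V (x k \<omega>) (z k \<omega>) - e k \<omega>)) \<longlonglongrightarrow> 0"
          by (rule error_decay, rule means(1))
        from tendsto_scaleR [OF tendsto_const [of \<tau>]
            matrix_vector_mult_tendsto_zero [OF this, of "feedback_matrix \<tau> V \<gamma>"]]
        show "(\<lambda>k. \<tau> *\<^sub>R (feedback_matrix \<tau> V \<gamma> *v
            prob_space.expectation \<Omega> (\<lambda>\<omega>. \<eta>_o V (x k \<omega>) (z k \<omega>) - e k \<omega>))) \<longlonglongrightarrow> 0"
          by simp
      qed
      then show "(\<lambda>k. prob_space.expectation \<Omega>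
          (\<lambda>\<omega>. time_dev (x k \<omega>) - \<theta>_unobs q (x k \<omega>) *\<^sub>R ones)) \<longlonglongrightarrow> 0"
        unfolding mean_dev [OF clp] by (rule matrix_vector_mult_tendsto_zero)
    qed
  qed
  fix x z u y em e k \<omega>
  assume "closed_loop_process \<Omega> \<tau> V W r P \<gamma> v w x z u y em e" "\<omega> \<in> space \<Omega>"
  then have "closed_loop \<tau> V W r P \<gamma> (\<lambda>k. v k \<omega>) (\<lambda>k. w k \<omega>) (\<lambda>k. x k \<omega>) (\<lambda>k. z k \<omega>)
      (\<lambda>k. u k \<omega>) (\<lambda>k. y k \<omega>) (\<lambda>k. em k \<omega>) (\<lambda>k. e k \<omega>)"
    by (simp add: closed_loop_process_def)
  from unobservable_step [OF this qW]
  show "\<eta>_unobs q (x (Suc k) \<omega>) =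
                 Amat \<tau> *v \<eta>_unobs q (x k \<omega>)
                 + col_left (row_right (\<beta>mat \<tau> \<otimes>\<^sub>K (rowvector q ** Jmat)))
                     *v lower (\<eta>_o V (x k \<omega>) (z k \<omega>))
                 + row_right (mat 1 \<otimes>\<^sub>K rowvector q) *v upper (v k \<omega>)" .
qed

end
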